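(* Let $\Lambda=(\Lambda_i)_{i\le\kappa}$ be a primitive representable substitution Delone $\kappa$-set in $\mathbb{R}^d$. Then the associated uniquely ergodic measure-preserving system $(X_\Lambda,\mathbb{R}^d,\mu)$ is not strongly mixing.
   Context: A $\kappa$-set $\Lambda=(\Lambda_i)_{i\le\kappa}$ is a tuple of pairwise disjoint subsets of $\mathbb{R}^d$, identified with $\{(x,i):x\in\Lambda_i\}\subset\mathbb{R}^d\times\{1,\dots,\kappa\}$; $\mathrm{supp}(\Lambda)=\bigcup_i\Lambda_i$. It is a Delone $\kappa$-set if each $\Lambda_i$ and $\mathrm{supp}(\Lambda)$ are Delone (relatively dense and uniformly discrete). A linear map $Q$ on $\mathbb{R}^d$ is expansive if all its (real and complex) eigenvalues have modulus $>1$. $\Lambda$ is a substitution Delone $\kappa$-set with expansion map $Q$ if it is a Delone $\kappa$-set and there are an expansive $Q$ and finite sets $\mathcal{D}_{ij}\subset\mathbb{R}^d$ such that $\Lambda_i=\bigcup_{j=1}^\kappa(Q\Lambda_j+\mathcal{D}_{ij})$ for $i\le\kappa$, all unions (over $j$ and over elements of $\mathcal{D}_{ij}$) being disjoint. It is primitive if some positive power of the matrix $(\#\mathcal{D}_{ij})_{i,j}$ has no zero entries. Let $(A_1,\dots,A_\kappa)$ be the unique family of nonempty compact sets solving $QA_j=\bigcup_{i=1}^\kappa(\mathcal{D}_{ij}+A_i)$, $j\le\kappa$, and $T_i=(A_i,i)$. $\Lambda$ is representable if the tiles $x+T_i=(x+A_i,i)$, $x\in\Lambda_i$, $i\le\kappa$,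 form a tiling of $\mathbb{R}^d$ (supports cover $\mathbb{R}^d$, distinct tiles have supports with disjoint interiors). Dynamical system: let $X$ be the collection of all Delone $\kappa$-sets in $\mathbb{R}^d$. For coloured sets, intersection with balls and addition of balls are applied to the $\mathbb{R}^d$-coordinate, keeping colours. Metric: $d(\Gamma,\Gamma')=\min\{2^{-1/2},\inf\{\epsilon>0:B_{1/\epsilon}(0)\cap\Gamma'\subset\Gamma+B_\epsilon(0),\ B_{1/\epsilon}(0)\cap\Gamma\subset\Gamma'+B_\epsilon(0)\}\}$. $X_\Lambda$ is the closure of $\{\Lambda-g:g\in\mathbb{R}^d\}$ in $X$; it is compact, and $\mathbb{R}^d$ acts by $\mathsf{T}_g\Gamma=\Gamma-g$. For $\Lambda$ as in the claim this system is uniquely ergodic, and $\mu$ is its unique invariant Borel probability measure. Strongly mixing means $\mu(A\cap\mathsf{T}_gB)\to\mu(A)\mu(B)$ as $|g|\to\infty$ for all Borel $A,B\subset X_\Lambda$. *)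

theory Defs
  imports "HOL-Probability.Probability" "HOL-Library.Set_Algebras"
begin

section \<open>Coloured Delone sets\<close>

text \<open>
  A \<open>\<kappa>\<close>-set is a function from colours to point sets; the colours are the elements of a
  finite type \<open>'k\<close>, so \<open>\<kappa> = CARD('k)\<close> and \<open>d = CARD('n)\<close>. Throughout, \<open>A + B\<close> and \<open>x +o A\<close>
  are the Minkowski sum and the translate from \<^theory>\<open>HOL-Library.Set_Algebras\<close>.
\<close>

definition relatively_dense :: "(real ^ 'n::finite) set \<Rightarrow> bool" where
  "relatively_dense S \<longleftrightarrow> (\<exists>R>0. S + cball 0 R = UNIV)"

definition delone :: "(real ^ 'n::finite) set \<Rightarrow> bool" where
  "delone S \<longleftrightarrow> relatively_dense S \<and> uniform_discrete S"

definition supp :: "('k::finite \<Rightarrow> (real ^ 'n::finite) set) \<Rightarrow> (real ^ 'n) set" where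
  "supp \<Gamma> = (\<Union>i. \<Gamma> i)"

definition delone_kset :: "('k::finite \<Rightarrow> (real ^ 'n::finite) set) \<Rightarrow> bool" where
  "delone_kset \<Gamma> \<longleftrightarrow> disjoint_family \<Gamma> \<and> (\<forall>i. delone (\<Gamma> i)) \<and> delone (supp \<Gamma>)"


section \<open>Substitution Delone sets\<close>

text \<open>Complex eigenvalues are those of the complexification of \<open>Q\<close>; they include the real ones.\<close>

definition complex_eigenvalue :: "(real ^ 'n \<Rightarrow> real ^ 'n::finite) \<Rightarrow> complex \<Rightarrow> bool" where
  "complex_eigenvalue Q z \<longleftrightarrow>
     (\<exists>v :: complex ^ 'n. v \<noteq> 0 \<and> (\<chi> i j. complex_of_real (matrix Q $ i $ j)) *v v = z *s v)"

definition expansive :: "(real ^ 'n \<Rightarrow> real ^ 'n::finite) \<Rightarrow> bool" where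
  "expansive Q \<longleftrightarrow> linear Q \<and> (\<forall>z. complex_eigenvalue Q z \<longrightarrow> 1 < norm z)"

definition substitution_delone_kset ::
  "(real ^ 'n \<Rightarrow> real ^ 'n) \<Rightarrow> ('k \<Rightarrow> 'k \<Rightarrow> (real ^ 'n) set) \<Rightarrow>
   ('k::finite \<Rightarrow> (real ^ 'n::finite) set) \<Rightarrow> bool" where
  "substitution_delone_kset Q \<D> \<Lambda> \<longleftrightarrow>
     delone_kset \<Lambda> \<and> expansive Q \<and> (\<forall>i j. finite (\<D> i j)) \<and>
     (\<forall>i. \<Lambda> i = (\<Union>j. Q ` \<Lambda> j + \<D> i j) \<and>
          disjoint_family_on (\<lambda>(j, a). a +o Q ` \<Lambda> j) (SIGMA j:UNIV. \<D> i j))"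

definition substitution_matrix :: "('k::finite \<Rightarrow> 'k \<Rightarrow> 'a set) \<Rightarrow> nat ^ 'k ^ 'k" where
  "substitution_matrix \<D> = (\<chi> i j. card (\<D> i j))"

definition primitive_substitution :: "('k::finite \<Rightarrow> 'k \<Rightarrow> 'a set) \<Rightarrow> bool" where
  "primitive_substitution \<D> \<longleftrightarrow>
     (\<exists>m>0. \<forall>i j. (((**) (substitution_matrix \<D>)) ^^ m) (mat 1) $ i $ j \<noteq> 0)"


section \<open>Representability\<close>

definition adjoint_family ::
  "(real ^ 'n \<Rightarrow> real ^ 'n) \<Rightarrow> ('k \<Rightarrow> 'k \<Rightarrow> (real ^ 'n) set) \<Rightarrow>
   ('k::finite \<Rightarrow> (real ^ 'n::finite) set) \<Rightarrow> bool" where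
  "adjoint_family Q \<D> A \<longleftrightarrow>
     (\<forall>i. A i \<noteq> {} \<and> compact (A i)) \<and> (\<forall>j. Q ` A j = (\<Union>i. \<D> i j + A i))"

text \<open>A tile is a pair of its support and its colour.\<close>

definition tiling :: "((real ^ 'n::finite) set \<times> 'k) set \<Rightarrow> bool" where
  "tiling \<T> \<longleftrightarrow>
     (\<Union>T\<in>\<T>. fst T) = UNIV \<and>
     pairwise (\<lambda>S T. interior (fst S) \<inter> interior (fst T) = {}) \<T>"

text \<open>
  For \<open>Q\<close> expansive and the substitution primitive, there is exactly one adjoint family, so the
  existential quantifier just names it.
\<close>

definition representable ::
  "(real ^ 'n \<Rightarrow> real ^ 'n) \<Rightarrow> ('k \<Rightarrow> 'k \<Rightarrow> (real ^ 'n) set) \<Rightarrow>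
   ('k::finite \<Rightarrow> (real ^ 'n::finite) set) \<Rightarrow> bool" where
  "representable Q \<D> \<Lambda> \<longleftrightarrow>
     (\<exists>A. adjoint_family Q \<D> A \<and> tiling {(x +o A i, i) |x i. x \<in> \<Lambda> i})"


section \<open>The metric on coloured Delone sets\<close>

definition kset_close ::
  "real \<Rightarrow> ('k::finite \<Rightarrow> (real ^ 'n::finite) set) \<Rightarrow> ('k \<Rightarrow> (real ^ 'n) set) \<Rightarrow> bool" where
  "kset_close \<epsilon> \<Gamma> \<Gamma>' \<longleftrightarrow>
     (\<forall>i. ball 0 (1 / \<epsilon>) \<inter> \<Gamma>' i \<subseteq> \<Gamma> i + ball 0 \<epsilon> \<and> ball 0 (1 / \<epsilon>) \<inter> \<Gamma> i \<subseteq> \<Gamma>' i + ball 0 \<epsilon>)"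

text \<open>
  \<open>min {c, inf S}\<close> is written as the infimum of \<open>S \<union> {c}\<close>. On Delone \<open>\<kappa>\<close>-sets \<open>S\<close> is never empty
  and the two agree; elsewhere this gives \<open>c\<close> when \<open>S\<close> is empty, where the real infimum would be
  unspecified.
\<close>

definition kset_dist ::
  "('k::finite \<Rightarrow> (real ^ 'n::finite) set) \<Rightarrow> ('k \<Rightarrow> (real ^ 'n) set) \<Rightarrow> real" where
  "kset_dist \<Gamma> \<Gamma>' = Inf (insert (1 / sqrt 2) {\<epsilon>. 0 < \<epsilon> \<and> kset_close \<epsilon> \<Gamma> \<Gamma>'})"

lemma kset_close_commute: "kset_close e \<Gamma> \<Gamma>' \<longleftrightarrow> kset_close e \<Gamma>' \<Gamma>"
  unfolding kset_close_def by blast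

lemma set_plus_ball_iff: "x \<in> A + ball 0 e \<longleftrightarrow> (\<exists>a\<in>A. dist a x < e)"
  for x :: "'a::real_normed_vector"
proof
  assume "x \<in> A + ball 0 e"
  then show "\<exists>a\<in>A. dist a x < e"
    by (auto simp: set_plus_def dist_norm intro!: bexI)
next
  assume "\<exists>a\<in>A. dist a x < e"
  then obtain a where a: "a \<in> A" "dist a x < e" by blast
  then have "x - a \<in> ball 0 e" by (simp add: dist_norm norm_minus_commute)
  then show "x \<in> A + ball 0 e"
    using a(1) set_plus_intro[of a A "x - a" "ball 0 e"] by simp
qed

lemma kset_close_half_trans:
  fixes X Y Z :: "(real ^ 'n::finite) set"
  assumes "ball 0 (1 / e) \<inter> X \<subseteq> Y + ball 0 e" "ball 0 (1 / f) \<inter> Y \<subseteq> Z + ball 0 f"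
    and "0 < e" "0 < f" "e + f < 1 / sqrt 2"
  shows "ball 0 (1 / (e + f)) \<inter> X \<subseteq> Z + ball 0 (e + f)"
proof
  fix x assume x: "x \<in> ball 0 (1 / (e + f)) \<inter> X"
  have small: "e + f < 1"
    using assms(5) by (smt (verit) divide_le_eq_1 real_sqrt_ge_1_iff)
  have "1 / (e + f) \<le> 1 / e" using assms by (simp add: frac_le)
  with x have "x \<in> ball 0 (1 / e) \<inter> X" by auto
  then obtain y where y: "y \<in> Y" "dist y x < e"
    using assms(1) set_plus_ball_iff by blast
  have "f * (e + f) \<le> 1"
    using assms small by (intro mult_le_one) auto
  then have "e * (f * (e + f)) \<le> e * 1"
    using assms by (intro mult_left_mono) auto
  then have "e + 1 / (e + f) \<le> 1 / f"
    using assms by (simp add: field_simps)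
  moreover have "norm y < e + 1 / (e + f)"
    using y(2) x norm_triangle_sub[of y x] by (simp add: dist_norm)
  ultimately have "y \<in> ball 0 (1 / f) \<inter> Y" using y(1) by simp
  then obtain z where z: "z \<in> Z" "dist z y < f"
    using assms(2) set_plus_ball_iff by blast
  have "dist z x < e + f" using dist_triangle[of z x y] y z by simp
  then show "x \<in> Z + ball 0 (e + f)" using z(1) set_plus_ball_iff by blast
qed

lemma kset_close_trans:
  assumes "kset_close e \<Gamma> \<Gamma>'" "kset_close f \<Gamma>' \<Gamma>''" "0 < e" "0 < f" "e + f < 1 / sqrt 2"
  shows "kset_close (e + f) \<Gamma> \<Gamma>''"
  unfolding kset_close_def
proof (intro allI conjI)
  fix i
  show "ball 0 (1 / (e + f)) \<inter> \<Gamma>'' i \<subseteq> \<Gamma> i + ball 0 (e + f)"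
    using kset_close_half_trans[of f "\<Gamma>'' i" "\<Gamma>' i" e "\<Gamma> i"] assms
    unfolding kset_close_def by (metis add.commute)
  show "ball 0 (1 / (e + f)) \<inter> \<Gamma> i \<subseteq> \<Gamma>'' i + ball 0 (e + f)"
    using kset_close_half_trans[of e "\<Gamma> i" "\<Gamma>' i" f "\<Gamma>'' i"] assms
    unfolding kset_close_def by metis
qed

lemma kset_dist_zero_subset:
  assumes z: "kset_dist \<Gamma> \<Gamma>' = 0" and ud: "uniform_discrete (\<Gamma> i)"
  shows "\<Gamma>' i \<subseteq> \<Gamma> i"
proof
  fix x assume x: "x \<in> \<Gamma>' i"
  have "closed (\<Gamma> i)"
    using ud unfolding uniform_discrete_def by (metis discrete_imp_closed dist_commute)
  moreover have "\<exists>y\<in>\<Gamma> i. dist y x < r" if "r > 0" for r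
  proof -
    define s where "s = min r (min (1 / sqrt 2) (1 / (norm x + 1)))"
    have "s > 0" using that by (simp add: s_def add_nonneg_pos)
    then have "kset_dist \<Gamma> \<Gamma>' < s" by (simp add: z)
    then obtain e where e: "e \<in> insert (1 / sqrt 2) {e. 0 < e \<and> kset_close e \<Gamma> \<Gamma>'}" "e < s"
      unfolding kset_dist_def by (meson cInf_lessD insert_not_empty)
    then have e': "0 < e" "kset_close e \<Gamma> \<Gamma>'" "e < r" "e < 1 / (norm x + 1)"
      by (auto simp: s_def)
    have "norm x + 1 < 1 / e"
      using e'(1,4) less_divide_eq[of e 1 "norm x + 1"] less_divide_eq[of "norm x + 1" 1 e]
      by (simp add: mult.commute add_nonneg_pos)
    then have "x \<in> ball 0 (1 / e) \<inter> \<Gamma>' i" using x by simp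
    then obtain y where "y \<in> \<Gamma> i" "dist y x < e"
      using e'(2) set_plus_ball_iff unfolding kset_close_def by blast
    then show ?thesis using e'(3) by (meson less_trans)
  qed
  ultimately show "x \<in> \<Gamma> i"
    by (metis closure_approachable closure_closed)
qed

lemma Metric_space_delone_ksets:
  "Metric_space (Collect delone_kset) (kset_dist :: ('k::finite \<Rightarrow> (real ^ 'n::finite) set) \<Rightarrow> _)"
proof
  fix \<Gamma> \<Gamma>' \<Gamma>'' :: "'k \<Rightarrow> (real ^ 'n) set"
  define S where
    "S = (\<lambda>\<Gamma> \<Gamma>' :: 'k \<Rightarrow> (real ^ 'n) set. insert (1 / sqrt 2) {e. 0 < e \<and> kset_close e \<Gamma> \<Gamma>'})"
  have d: "kset_dist \<Gamma> \<Gamma>' = Inf (S \<Gamma> \<Gamma>')" for \<Gamma> \<Gamma>' by (simp add: kset_dist_def S_def)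
  have pos: "0 < e" if "e \<in> S \<Gamma> \<Gamma>'" for e \<Gamma> \<Gamma>' using that by (auto simp: S_def)
  have ne: "S \<Gamma> \<Gamma>' \<noteq> {}" for \<Gamma> \<Gamma>' by (simp add: S_def)
  have bdd: "bdd_below (S \<Gamma> \<Gamma>')" for \<Gamma> \<Gamma>'
    by (meson bdd_belowI less_imp_le pos)
  show nonneg: "0 \<le> kset_dist \<Gamma> \<Gamma>'" for \<Gamma> \<Gamma>' :: "'k \<Rightarrow> (real ^ 'n) set"
    unfolding d by (meson cInf_greatest less_imp_le ne pos)
  show comm: "kset_dist \<Gamma> \<Gamma>' = kset_dist \<Gamma>' \<Gamma>" for \<Gamma> \<Gamma>' :: "'k \<Rightarrow> (real ^ 'n) set"
    by (simp add: kset_dist_def kset_close_commute)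
  show "kset_dist \<Gamma> \<Gamma>' = 0 \<longleftrightarrow> \<Gamma> = \<Gamma>'"
    if "\<Gamma> \<in> Collect delone_kset" "\<Gamma>' \<in> Collect delone_kset"
  proof
    assume z: "kset_dist \<Gamma> \<Gamma>' = 0"
    then have z': "kset_dist \<Gamma>' \<Gamma> = 0" using comm by simp
    have "\<Gamma> i = \<Gamma>' i" for i
      using kset_dist_zero_subset[OF z, of i] kset_dist_zero_subset[OF z', of i] that
      by (auto simp: delone_kset_def delone_def)
    then show "\<Gamma> = \<Gamma>'" by blast
  next
    assume eq: "\<Gamma> = \<Gamma>'"
    have "e \<in> S \<Gamma> \<Gamma>" if "0 < e" for e
      using that by (auto simp: S_def kset_close_def set_plus_ball_iff)
        (metis dist_self)+
    then have "kset_dist \<Gamma> \<Gamma> \<le> e" if "0 < e" for e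
      using that bdd by (simp add: d cInf_lower)
    then have "kset_dist \<Gamma> \<Gamma> \<le> 0" by (meson dense not_le)
    then show "kset_dist \<Gamma> \<Gamma>' = 0" using nonneg eq by (metis order_antisym)
  qed
  have sub: "kset_dist \<Gamma> \<Gamma>'' \<le> e + f" if e: "e \<in> S \<Gamma> \<Gamma>'" and f: "f \<in> S \<Gamma>' \<Gamma>''" for e f
  proof (cases "e + f < 1 / sqrt 2")
    case True
    with e f pos[OF e] pos[OF f] have "kset_close e \<Gamma> \<Gamma>'" "kset_close f \<Gamma>' \<Gamma>''"
      by (auto simp: S_def)
    then have "e + f \<in> S \<Gamma> \<Gamma>''"
      using kset_close_trans True pos[OF e] pos[OF f] by (auto simp: S_def)
    then show ?thesis unfolding d using bdd by (rule cInf_lower)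
  next
    case False
    have "kset_dist \<Gamma> \<Gamma>'' \<le> 1 / sqrt 2"
      unfolding d using bdd by (rule cInf_lower[rotated]) (simp add: S_def)
    with False show ?thesis by simp
  qed
  have "kset_dist \<Gamma> \<Gamma>'' - f \<le> kset_dist \<Gamma> \<Gamma>'" if "f \<in> S \<Gamma>' \<Gamma>''" for f
    unfolding d[of \<Gamma> \<Gamma>'] by (rule cInf_greatest[OF ne]) (use sub that in force)
  then have "kset_dist \<Gamma> \<Gamma>'' - kset_dist \<Gamma> \<Gamma>' \<le> kset_dist \<Gamma>' \<Gamma>''"
    unfolding d[of \<Gamma>' \<Gamma>''] by (intro cInf_greatest[OF ne]) force
  then show "kset_dist \<Gamma> \<Gamma>'' \<le> kset_dist \<Gamma> \<Gamma>' + kset_dist \<Gamma>' \<Gamma>''" by simp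
qed

definition kset_topology :: "('k::finite \<Rightarrow> (real ^ 'n::finite) set) topology" where
  "kset_topology = Metric_space.mtopology (Collect delone_kset) kset_dist"


section \<open>The dynamical system\<close>

definition translate ::
  "real ^ 'n \<Rightarrow> ('k::finite \<Rightarrow> (real ^ 'n::finite) set) \<Rightarrow> ('k \<Rightarrow> (real ^ 'n) set)" where
  "translate g \<Gamma> = (\<lambda>i. (\<lambda>x. x - g) ` \<Gamma> i)"

definition orbit_closure ::
  "('k::finite \<Rightarrow> (real ^ 'n::finite) set) \<Rightarrow> ('k \<Rightarrow> (real ^ 'n) set) set" where
  "orbit_closure \<Lambda> = kset_topology closure_of (range (\<lambda>g. translate g \<Lambda>))"

definition orbit_closure_borel ::
  "('k::finite \<Rightarrow> (real ^ 'n::finite) set) \<Rightarrow> ('k \<Rightarrow> (real ^ 'n) set) measure" where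
  "orbit_closure_borel \<Lambda> =
     sigma (orbit_closure \<Lambda>) {U. openin (subtopology kset_topology (orbit_closure \<Lambda>)) U}"

definition invariant_borel_probability ::
  "('k::finite \<Rightarrow> (real ^ 'n::finite) set) \<Rightarrow> ('k \<Rightarrow> (real ^ 'n) set) measure \<Rightarrow> bool" where
  "invariant_borel_probability \<Lambda> \<mu> \<longleftrightarrow>
     prob_space \<mu> \<and> sets \<mu> = sets (orbit_closure_borel \<Lambda>) \<and>
     (\<forall>g. \<forall>B\<in>sets \<mu>. emeasure \<mu> (translate g ` B) = emeasure \<mu> B)"

definition strongly_mixing ::
  "('k::finite \<Rightarrow> (real ^ 'n::finite) set) measure \<Rightarrow> bool" where
  "strongly_mixing \<mu> \<longleftrightarrow>
     (\<forall>A\<in>sets \<mu>. \<forall>B\<in>sets \<mu>.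
        ((\<lambda>g. measure \<mu> (A \<inter> translate g ` B)) \<longlongrightarrow> measure \<mu> A * measure \<mu> B) at_infinity)"

end

theory Submission
  imports Defs "HOL-Computational_Algebra.Fundamental_Theorem_Algebra"
begin

text \<open>
  By expansiveness, for each colour \<open>i\<close> some level \<open>m\<close> and colour \<open>j\<close> have two distinct level-\<open>m\<close> digits
  in \<open>\<D>\<^sup>m\<^sub>i\<^sub>j\<close>, so there is a vector \<open>v\<^sub>i \<noteq> 0\<close> for which \<open>{x \<in> \<Lambda>\<^sub>i. x + v\<^sub>i \<in> \<Lambda>\<^sub>i}\<close> is relatively dense.
  Applying the level-\<open>n\<close> substitution to such a pair gives points \<open>z, z + Q\<^sup>n v\<^sub>i\<close> of \<open>\<Lambda>\<^sub>j\<close>, and for a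
  suitable \<open>i\<close> depending on \<open>n\<close> the density of these \<open>z\<close> is bounded below independently of \<open>n\<close>.
  Hence, if \<open>U\<close> is a small cube of side \<open>s\<close>, the event that a point set has a point of colour \<open>j\<close> in
  \<open>U\<close> and another one in \<open>U + Q\<^sup>n v\<^sub>i\<close> has probability at least \<open>C s\<^sup>d\<close>. The event that it has one in
  \<open>U\<close> has probability at most \<open>C' s\<^sup>d\<close>, so mixing along \<open>Q\<^sup>n v\<^sub>i \<rightarrow> \<infinity>\<close> would give
  \<open>C s\<^sup>d \<le> (C' s\<^sup>d)\<^sup>2\<close> for all small \<open>s\<close>.
\<close>

section \<open>Expansive maps\<close>

text \<open>This is the vector \<open>p(B) w\<close>, evaluated by Horner's scheme so that the
  recursion at \<open>pCons\<close> is immediate and no matrix power is formed.\<close>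

definition poly_apply :: "complex ^ 'n ^ 'n \<Rightarrow> complex poly \<Rightarrow> complex ^ 'n \<Rightarrow> complex ^ 'n::finite" where
  "poly_apply B p w = fold_coeffs (\<lambda>a u. a *s w + B *v u) p 0"

lemma poly_apply_0 [simp]: "poly_apply B 0 w = 0"
  by (simp add: poly_apply_def)

lemma poly_apply_pCons [simp]: "poly_apply B (pCons a p) w = a *s w + B *v poly_apply B p w"
  by (cases "p = 0 \<and> a = 0") (auto simp: poly_apply_def)

lemma poly_apply_add: "poly_apply B (p + q) w = poly_apply B p w + poly_apply B q w"
  by (induction p q rule: poly_induct2)
    (simp_all add: vec.add vec.scale_left_distrib algebra_simps)

lemma poly_apply_smult: "poly_apply B (smult c p) w = c *s poly_apply B p w"
  by (induction p) (simp_all add: vec.scale_right_distrib vec.scale)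

text \<open>A polynomial in \<open>B\<close> commutes with \<open>B\<close>, hence with
  \<open>B - l\<close>.\<close>

lemma poly_apply_linear:
  "poly_apply B p (B *v w - l *s w) = B *v poly_apply B p w - l *s poly_apply B p w"
  by (induction p)
    (simp_all add: vec.diff vec.add vec.scale vec.scale_right_distrib vec.scale_right_diff_distrib
      mult.commute)

lemma poly_apply_linear_factor:
  "poly_apply B ([:- l, 1:] * p) w = B *v poly_apply B p w - l *s poly_apply B p w"
proof -
  have "[:- l, 1:] * p = smult (- l) p + pCons 0 p" by simp
  then show ?thesis
    by (simp add: poly_apply_add poly_apply_smult del: smult_minus_left)
qed

lemma poly_apply_monom: "poly_apply B (monom c k) w = c *s (((*v) B) ^^ k) w"
  by (induction k) (simp_all add: monom_0 monom_Suc vec.scale)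

lemma poly_apply_sum: "poly_apply B (sum f A) w = (\<Sum>k\<in>A. poly_apply B (f k) w)"
  by (induction A rule: infinite_finite_induct) (simp_all add: poly_apply_add)

text \<open>The vectors \<open>w\<close>, \<open>B w\<close>, ..., \<open>B^N w\<close> outnumber
  the real dimension \<open>N\<close>, so a linear relation with real coefficients holds among them;
  its coefficients are those of \<open>p\<close>.\<close>

lemma annihilating_poly_exists:
  fixes B :: "complex ^ 'n ^ 'n::finite"
  shows "\<exists>p. p \<noteq> 0 \<and> poly_apply B p w = 0"
proof -
  define f where "f k = (((*v) B) ^^ k) w" for k
  define N where "N = DIM(complex ^ 'n)"
  show ?thesis
  proof (cases "inj_on f {..N}")
    \<comment> \<open>Dependence is a property of sets and cannot see a repeated vector, so a
      coincidence \<open>B^k w = B^l w\<close> is treated apart and yields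
      \<open>X^k - X^l\<close>.\<close>
    case False
    then obtain k l where kl: "k \<noteq> l" "f k = f l"
      by (auto simp: inj_on_def)
    have "poly_apply B (monom 1 k + monom (- 1) l) w = 0"
      using kl(2) by (simp add: poly_apply_add poly_apply_monom f_def)
    moreover have "coeff (monom 1 k + monom (- 1) l :: complex poly) k \<noteq> 0"
      using kl(1) by simp
    then have "monom 1 k + monom (- 1) l \<noteq> (0 :: complex poly)"
      by (metis coeff_0)
    ultimately show ?thesis by blast
  next
    case True
    then have "card (f ` {..N}) > DIM(complex ^ 'n)"
      by (simp add: card_image N_def)
    then have "dependent (f ` {..N})"
      by (intro dependent_biggerset) auto
    then obtain u v where u: "(\<Sum>x\<in>f ` {..N}. u x *\<^sub>R x) = 0" and v: "v \<in> f ` {..N}" "u v \<noteq> 0"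
      by (subst (asm) dependent_finite) auto
    define p where "p = (\<Sum>k\<le>N. monom (complex_of_real (u (f k))) k)"
    have eq: "complex_of_real r *s x = r *\<^sub>R x" for r and x :: "complex ^ 'n"
      by (simp add: vec_eq_iff scaleR_conv_of_real[where 'a = complex])
    have "poly_apply B p w = (\<Sum>k\<le>N. u (f k) *\<^sub>R f k)"
      by (simp add: p_def poly_apply_sum poly_apply_monom f_def eq)
    also have "\<dots> = 0" using u True by (simp add: sum.reindex)
    finally have "poly_apply B p w = 0" .
    moreover from v obtain k where k: "k \<le> N" "u (f k) \<noteq> 0" by auto
    have "coeff p k = complex_of_real (u (f k))"
      using k(1) by (simp add: p_def coeff_sum)
    then have "p \<noteq> 0" using k(2) by auto
    ultimately show ?thesis by blast
  qed
qed

section \<open>Decay of the powers of a matrix whose eigenvalues have modulus below one\<close>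

lemma linear_recurrence_tendsto_0:
  fixes a b :: "nat \<Rightarrow> 'a::real_normed_vector"
  assumes "\<And>n. norm (a (Suc n)) \<le> r * norm (a n) + norm (b n)" and "0 \<le> r" "r < 1" and "b \<longlonglongrightarrow> 0"
  shows "a \<longlonglongrightarrow> 0"
proof (rule metric_LIMSEQ_I)
  fix e :: real assume e: "0 < e"
  \<comment> \<open>With this choice \<open>e / 2\<close> is the fixed point of
    \<open>x \<mapsto> r * x + d\<close>.\<close>
  define d where "d = e * (1 - r) / 2"
  have "d > 0" using e assms by (simp add: d_def)
  then obtain N where N: "\<And>n. n \<ge> N \<Longrightarrow> norm (b n) < d"
    using metric_LIMSEQ_D[OF assms(4)] by (auto simp: dist_norm)
  have bound: "norm (a (N + m)) \<le> r ^ m * norm (a N) + e / 2" for m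
  proof (induction m)
    case 0
    show ?case using e by simp
  next
    case (Suc m)
    have "norm (a (N + Suc m)) \<le> r * norm (a (N + m)) + norm (b (N + m))"
      using assms(1)[of "N + m"] by simp
    also have "\<dots> \<le> r * (r ^ m * norm (a N) + e / 2) + d"
      using Suc assms(2) N[of "N + m"] by (intro add_mono mult_left_mono) auto
    also have "\<dots> = r ^ Suc m * norm (a N) + e / 2"
      by (simp add: d_def field_simps)
    finally show ?case .
  qed
  have "(\<lambda>m. r ^ m * norm (a N)) \<longlonglongrightarrow> 0"
    using assms by (intro tendsto_mult_left_zero LIMSEQ_realpow_zero)
  then obtain M where M: "\<And>m. m \<ge> M \<Longrightarrow> r ^ m * norm (a N) < e / 2"
    using e assms(2) metric_LIMSEQ_D[of _ 0 "e / 2"] by (fastforce simp: dist_norm)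
  show "\<exists>n0. \<forall>n\<ge>n0. dist (a n) 0 < e"
  proof (intro exI allI impI)
    fix n assume "n \<ge> N + M"
    then obtain m where "n = N + m" "m \<ge> M" by (metis add.assoc le_add1 le_iff_add)
    then show "dist (a n) 0 < e" using bound[of m] M[of m] by simp
  qed
qed

text \<open>
  A linear factor \<open>X - l\<close> of the annihilating polynomial either has \<open>l\<close> as an eigenvalue, and then
  the powers of \<open>B\<close> on \<open>w\<close> satisfy a contracting recurrence, or can be cancelled.
\<close>

lemma matrix_powers_tendsto_0_if_poly_apply_0:
  fixes B :: "complex ^ 'n ^ 'n::finite"
  assumes ev: "\<And>l v. v \<noteq> 0 \<Longrightarrow> B *v v = l *s v \<Longrightarrow> norm l < 1"
    and "p \<noteq> 0" "poly_apply B p w = 0"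
  shows "(\<lambda>k. (((*v) B) ^^ k) w) \<longlonglongrightarrow> 0"
  using assms(2,3)
proof (induction "degree p" arbitrary: p w)
  case 0
  then obtain c where "p = [:c:]" by (metis degree_eq_zeroE)
  with 0 have "w = 0" by (simp add: vector_mul_eq_0)
  moreover have "(((*v) B) ^^ k) 0 = 0" for k by (induction k) auto
  ultimately show ?case by simp
next
  case (Suc n)
  from Suc(2) have "\<not> constant (poly p)" by (simp add: constant_degree)
  then obtain l where "poly p l = 0" using fundamental_theorem_of_algebra by blast
  then obtain q where p: "p = [:- l, 1:] * q" by (metis dvdE poly_eq_0_iff_dvd)
  with Suc(3) have q: "q \<noteq> 0" by auto
  have "degree p = Suc (degree q)"
    using q unfolding p by (subst degree_mult_eq) auto
  with Suc(2) have deg: "n = degree q" by simp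
  have pw: "B *v poly_apply B q w = l *s poly_apply B q w"
    using Suc(4) unfolding p poly_apply_linear_factor by simp
  show ?case
  proof (cases "poly_apply B q w = 0")
    case True
    then show ?thesis using Suc(1)[OF deg q] by blast
  next
    case False
    with pw ev have l: "norm l < 1" by blast
    \<comment> \<open>The forcing term of the recurrence is the orbit of
      \<open>B *v w - l *s w\<close>. Since \<open>q\<close> annihilates this vector, the induction
      hypothesis, which ranges over all vectors, makes the term decay.\<close>
    have "poly_apply B q (B *v w - l *s w) = 0"
      using pw by (simp add: poly_apply_linear)
    then have u: "(\<lambda>k. (((*v) B) ^^ k) (B *v w - l *s w)) \<longlonglongrightarrow> 0"
      using Suc(1)[OF deg q] by blast
    have "(((*v) B) ^^ k) (B *v w - l *s w) = (((*v) B) ^^ Suc k) w - l *s (((*v) B) ^^ k) w" for k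
      by (induction k) (simp_all add: vec.diff vec.scale)
    then have "(((*v) B) ^^ Suc k) w = l *s (((*v) B) ^^ k) w + (((*v) B) ^^ k) (B *v w - l *s w)" for k
      by simp
    moreover have "norm (l *s x) = norm l * norm x" for x :: "complex ^ 'n"
      by (simp add: norm_vec_def norm_mult L2_set_right_distrib)
    ultimately have "norm ((((*v) B) ^^ Suc k) w)
        \<le> norm l * norm ((((*v) B) ^^ k) w) + norm ((((*v) B) ^^ k) (B *v w - l *s w))" for k
      by (metis norm_triangle_ineq)
    then show ?thesis by (rule linear_recurrence_tendsto_0[OF _ _ l u]) simp
  qed
qed

lemma matrix_powers_tendsto_0:
  fixes B :: "complex ^ 'n ^ 'n::finite"
  assumes "\<And>l v. v \<noteq> 0 \<Longrightarrow> B *v v = l *s v \<Longrightarrow> norm l < 1"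
  shows "(\<lambda>k. (((*v) B) ^^ k) w) \<longlonglongrightarrow> 0"
proof -
  obtain p where "p \<noteq> 0" "poly_apply B p w = 0"
    using annihilating_poly_exists by blast
  with assms show ?thesis by (rule matrix_powers_tendsto_0_if_poly_apply_0)
qed

section \<open>Complexification, and the growth of the powers of an expansive map\<close>

definition complexify :: "real ^ 'n \<Rightarrow> complex ^ 'n::finite" where
  "complexify x = (\<chi> i. complex_of_real (x $ i))"

definition complexify_matrix :: "(real ^ 'n \<Rightarrow> real ^ 'n) \<Rightarrow> complex ^ 'n ^ 'n::finite" where
  "complexify_matrix P = (\<chi> i j. complex_of_real (matrix P $ i $ j))"

lemma complexify_matrix_mult_vector:
  assumes "linear P"
  shows "complexify_matrix P *v complexify x = complexify (P x)"
proof -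
  have "P x = matrix P *v x"
    using fun_cong[OF matrix_vector_mul(2)[OF assms], of x] by (rule sym)
  then have "P x $ i = (\<Sum>j\<in>UNIV. matrix P $ i $ j * x $ j)" for i
    by (simp only: matrix_vector_mult_def vec_lambda_beta)
  then show ?thesis
    by (simp only: vec_eq_iff complexify_matrix_def complexify_def matrix_vector_mult_def
        vec_lambda_beta of_real_sum of_real_mult simp_thms)
qed

lemma complexify_matrix_compose:
  assumes "linear P" "linear Q"
  shows "complexify_matrix (P \<circ> Q) = complexify_matrix P ** complexify_matrix Q"
  unfolding complexify_matrix_def matrix_compose[OF assms(2,1)] matrix_matrix_mult_def
  by (simp only: vec_eq_iff vec_lambda_beta of_real_sum of_real_mult simp_thms)

lemma complexify_matrix_id: "complexify_matrix id = mat 1"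
  by (simp add: vec_eq_iff complexify_matrix_def matrix_id_mat_1 mat_def)

text \<open>A non-zero kernel vector would complexify to an eigenvector for the eigenvalue 0, whose
  modulus does not exceed 1.\<close>

lemma expansive_bij:
  assumes "expansive Q"
  shows "bij Q"
proof -
  have lin: "linear Q" using assms by (simp add: expansive_def)
  have "x = 0" if "Q x = 0" for x
  proof (rule ccontr)
    assume "x \<noteq> 0"
    then have "complexify x \<noteq> 0" by (simp add: complexify_def vec_eq_iff)
    moreover have "complexify_matrix Q *v complexify x = 0 *s complexify x"
      using that by (simp add: complexify_matrix_mult_vector[OF lin]) (simp add: complexify_def vec_eq_iff)
    ultimately have "complex_eigenvalue Q 0"
      unfolding complex_eigenvalue_def complexify_matrix_def by blast
    then have "1 < norm (0 :: complex)" using assms unfolding expansive_def by blast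
    then show False by simp
  qed
  then have "inj Q" using lin by (simp add: linear_injective_0)
  then show ?thesis by (intro bijI linear_inj_imp_surj lin)
qed

text \<open>The eigenvalues of the complexified inverse are reciprocals of eigenvalues of
  \<open>Q\<close>, so they lie inside the unit disc and the powers decay on every vector.\<close>

lemma expansive_inv_powers_tendsto_0:
  assumes "expansive Q"
  shows "(\<lambda>k. (inv Q ^^ k) x) \<longlonglongrightarrow> 0"
proof -
  have lin: "linear Q" using assms by (simp add: expansive_def)
  have bij: "bij Q" by (rule expansive_bij[OF assms])
  have lininv: "linear (inv Q)"
    using lin bij by (simp add: bij_is_inj bij_is_surj inj_linear_imp_inv_linear)
  let ?B = "complexify_matrix (inv Q)"
  have QB: "complexify_matrix Q ** ?B = mat 1"
    using complexify_matrix_compose[OF lin lininv] bij_is_surj[OF bij]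
    by (simp add: complexify_matrix_id surj_iff)
  have "norm l < 1" if v: "v \<noteq> 0" "?B *v v = l *s v" for l v
  proof -
    have "v = complexify_matrix Q *v (?B *v v)"
      using QB by (simp add: matrix_vector_mul_assoc)
    then have eq: "v = l *s (complexify_matrix Q *v v)"
      unfolding v(2) by (simp add: vec.scale)
    then have "l \<noteq> 0" using v(1) by (metis vec.scale_zero_left)
    then have "complexify_matrix Q *v v = (1 / l) *s v"
      using arg_cong[OF eq, of "\<lambda>x. (1 / l) *s x"] by (simp add: vector_smult_assoc)
    then have "complex_eigenvalue Q (1 / l)"
      using v(1) unfolding complex_eigenvalue_def complexify_matrix_def by blast
    then have "1 < norm (1 / l)" using assms unfolding expansive_def by blast
    then show ?thesis using \<open>l \<noteq> 0\<close> by (simp add: norm_divide field_simps)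
  qed
  then have "(\<lambda>k. (((*v) ?B) ^^ k) (complexify x)) \<longlonglongrightarrow> 0" by (rule matrix_powers_tendsto_0)
  moreover have "(((*v) ?B) ^^ k) (complexify x) = complexify ((inv Q ^^ k) x)" for k
    by (induction k) (simp_all add: complexify_matrix_mult_vector[OF lininv])
  ultimately have lim: "(\<lambda>k. complexify ((inv Q ^^ k) x)) \<longlonglongrightarrow> 0" by simp
  show ?thesis
  proof (rule vec_tendstoI)
    fix i
    have "(\<lambda>k. complex_of_real ((inv Q ^^ k) x $ i)) \<longlonglongrightarrow> 0"
      using tendsto_vec_nth[OF lim, of i] by (simp add: complexify_def)
    then show "(\<lambda>k. (inv Q ^^ k) x $ i) \<longlonglongrightarrow> 0 $ i"
      by (metis of_real_0 tendsto_of_real_iff zero_index)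
  qed
qed

text \<open>Decay of the inverse powers on a basis gives
  \<open>S k \<longlonglongrightarrow> 0\<close> for a bound \<open>S k\<close> on the operator norm
  of the \<open>k\<close>-th inverse power. Applied to \<open>(Q ^^ k) v\<close> this says
  \<open>norm v \<le> S k * norm ((Q ^^ k) v)\<close>.\<close>

lemma expansive_power_norm_at_top:
  assumes "expansive Q" "v \<noteq> 0"
  shows "filterlim (\<lambda>k. norm ((Q ^^ k) v)) at_top sequentially"
proof -
  let ?P = "\<lambda>k. inv Q ^^ k"
  have lin: "linear Q" using assms by (simp add: expansive_def)
  have bij: "bij Q" by (rule expansive_bij[OF assms(1)])
  have lininv: "linear (inv Q)"
    using lin bij by (simp add: bij_is_inj bij_is_surj inj_linear_imp_inv_linear)
  have linP: "linear (?P k)" for k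
  proof (induction k)
    case 0
    show ?case unfolding funpow.simps(1) by (rule linear_id)
  next
    case (Suc k)
    then show ?case unfolding funpow.simps(2) by (rule linear_compose[OF _ lininv])
  qed
  define S where "S k = (\<Sum>b\<in>Basis. norm (?P k b))" for k
  have S: "S \<longlonglongrightarrow> 0"
    unfolding S_def
    by (intro tendsto_null_sum tendsto_norm_zero expansive_inv_powers_tendsto_0 assms(1))
  have bound: "norm (?P k x) \<le> S k * norm x" for k x
  proof -
    have "?P k x = ?P k (\<Sum>b\<in>Basis. (x \<bullet> b) *\<^sub>R b)" by (simp add: euclidean_representation)
    also have "\<dots> = (\<Sum>b\<in>Basis. (x \<bullet> b) *\<^sub>R ?P k b)"
      by (simp add: linear_sum[OF linP] linear_scale[OF linP])
    also have "norm \<dots> \<le> (\<Sum>b\<in>Basis. \<bar>x \<bullet> b\<bar> * norm (?P k b))"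
      by (rule order_trans[OF norm_sum]) simp
    also have "\<dots> \<le> (\<Sum>b\<in>Basis. norm x * norm (?P k b))"
      by (intro sum_mono mult_right_mono Basis_le_norm) auto
    also have "\<dots> = S k * norm x"
      unfolding S_def sum_distrib_left[symmetric] by (rule mult.commute)
    finally show ?thesis .
  qed
  have inv: "?P k ((Q ^^ k) v) = v" for k
    by (simp add: inv_fn[OF bij, symmetric] bij_fn[OF bij] bij_is_inj)
  show ?thesis
    unfolding filterlim_at_top_gt[where c = 0]
  proof (intro allI impI)
    fix Z :: real assume Z: "0 < Z"
    have "\<forall>\<^sub>F k in sequentially. S k < norm v / Z"
      using order_tendstoD(2)[OF S] Z assms(2) by simp
    then show "\<forall>\<^sub>F k in sequentially. Z \<le> norm ((Q ^^ k) v)"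
    proof eventually_elim
      case (elim k)
      have "norm v \<le> S k * norm ((Q ^^ k) v)" using bound[of k "(Q ^^ k) v"] inv by simp
      also have "\<dots> \<le> norm v / Z * norm ((Q ^^ k) v)"
        using elim by (intro mult_right_mono) auto
      finally show ?case using Z assms(2) by (simp add: field_simps)
    qed
  qed
qed

section \<open>Digit decompositions\<close>

text \<open>One bijection packs together the set equation and the disjointness of its pieces: every
  point has exactly one digit expansion. The map \<open>R\<close> will be a power of
  \<open>Q\<close>, and \<open>E\<close> the digit sets of that level.\<close>

definition decomposition ::
  "(real ^ 'n \<Rightarrow> real ^ 'n) \<Rightarrow> ('k \<Rightarrow> 'k \<Rightarrow> (real ^ 'n) set) \<Rightarrow>
   ('k::finite \<Rightarrow> (real ^ 'n::finite) set) \<Rightarrow> bool" where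
  "decomposition R E \<Lambda> \<longleftrightarrow> (\<forall>i j. finite (E i j)) \<and>
     (\<forall>i. bij_betw (\<lambda>(j, d, x). R x + d) (SIGMA j:UNIV. E i j \<times> \<Lambda> j) (\<Lambda> i))"

lemma decomposition_finite: "decomposition R E \<Lambda> \<Longrightarrow> finite (E i j)"
  by (simp add: decomposition_def)

lemma decomposition_mem:
  assumes "decomposition R E \<Lambda>" "d \<in> E i j" "x \<in> \<Lambda> j"
  shows "R x + d \<in> \<Lambda> i"
proof -
  have "bij_betw (\<lambda>(j, d, x). R x + d) (SIGMA j:UNIV. E i j \<times> \<Lambda> j) (\<Lambda> i)"
    using assms(1) by (simp add: decomposition_def)
  from bij_betwE[OF this] assms(2,3) show ?thesis by auto
qed

lemma decomposition_cases:
  assumes "decomposition R E \<Lambda>" "z \<in> \<Lambda> i"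
  obtains j d x where "d \<in> E i j" "x \<in> \<Lambda> j" "z = R x + d"
proof -
  have "bij_betw (\<lambda>(j, d, x). R x + d) (SIGMA j:UNIV. E i j \<times> \<Lambda> j) (\<Lambda> i)"
    using assms(1) by (simp add: decomposition_def)
  from bij_betw_imp_surj_on[OF this] assms(2)
  have "z \<in> (\<lambda>(j, d, x). R x + d) ` (SIGMA j:UNIV. E i j \<times> \<Lambda> j)" by (simp only:)
  then show ?thesis using that by auto
qed

lemma decomposition_unique:
  assumes "decomposition R E \<Lambda>" "d \<in> E i j" "x \<in> \<Lambda> j" "d' \<in> E i j'" "x' \<in> \<Lambda> j'"
    and "R x + d = R x' + d'"
  shows "j = j' \<and> d = d' \<and> x = x'"
proof -
  have "bij_betw (\<lambda>(j, d, x). R x + d) (SIGMA j:UNIV. E i j \<times> \<Lambda> j) (\<Lambda> i)"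
    using assms(1) by (simp add: decomposition_def)
  from inj_onD[OF bij_betw_imp_inj_on[OF this], of "(j, d, x)" "(j', d', x')"] assms(2-)
  show ?thesis by auto
qed

lemma decompositionI:
  assumes "\<And>i j. finite (E i j)"
    and "\<And>i j d x. d \<in> E i j \<Longrightarrow> x \<in> \<Lambda> j \<Longrightarrow> R x + d \<in> \<Lambda> i"
    and "\<And>i z. z \<in> \<Lambda> i \<Longrightarrow> \<exists>j. \<exists>d\<in>E i j. \<exists>x\<in>\<Lambda> j. z = R x + d"
    and "\<And>i j j' d d' x x'. d \<in> E i j \<Longrightarrow> x \<in> \<Lambda> j \<Longrightarrow> d' \<in> E i j' \<Longrightarrow> x' \<in> \<Lambda> j' \<Longrightarrow>
      R x + d = R x' + d' \<Longrightarrow> j = j' \<and> d = d' \<and> x = x'"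
  shows "decomposition R E \<Lambda>"
  unfolding decomposition_def
proof (intro conjI allI)
  fix i
  show "bij_betw (\<lambda>(j, d, x). R x + d) (SIGMA j:UNIV. E i j \<times> \<Lambda> j) (\<Lambda> i)"
  proof (rule bij_betw_imageI)
    show "inj_on (\<lambda>(j, d, x). R x + d) (SIGMA j:UNIV. E i j \<times> \<Lambda> j)"
      using assms(4) by (auto simp: inj_on_def)
    show "(\<lambda>(j, d, x). R x + d) ` (SIGMA j:UNIV. E i j \<times> \<Lambda> j) = \<Lambda> i"
    proof (intro equalityI subsetI)
      fix z assume "z \<in> \<Lambda> i"
      then obtain j d x where "d \<in> E i j" "x \<in> \<Lambda> j" "z = R x + d" using assms(3) by blast
      then show "z \<in> (\<lambda>(j, d, x). R x + d) ` (SIGMA j:UNIV. E i j \<times> \<Lambda> j)"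
        by (intro image_eqI[of _ _ "(j, d, x)"]) auto
    qed (use assms(2) in auto)
  qed
qed (rule assms(1))

text \<open>Disjointness of the pieces determines the colour and the digit; injectivity of
  \<open>Q\<close> then determines the point.\<close>

lemma substitution_decomposition:
  assumes sub: "substitution_delone_kset Q \<D> \<Lambda>" and inj: "inj Q"
  shows "decomposition Q \<D> \<Lambda>"
proof (rule decompositionI)
  have eq: "\<Lambda> i = (\<Union>j. Q ` \<Lambda> j + \<D> i j)"
    and disj: "disjoint_family_on (\<lambda>(j, a). a +o Q ` \<Lambda> j) (SIGMA j:UNIV. \<D> i j)" for i
    using sub unfolding substitution_delone_kset_def by blast+
  show "finite (\<D> i j)" for i j
    using sub unfolding substitution_delone_kset_def by blast
  show "Q x + d \<in> \<Lambda> i" if "d \<in> \<D> i j" "x \<in> \<Lambda> j" for i j d x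
    unfolding eq[of i] using that by (auto intro!: set_plus_intro)
  show "\<exists>j. \<exists>d\<in>\<D> i j. \<exists>x\<in>\<Lambda> j. z = Q x + d" if "z \<in> \<Lambda> i" for i z
    using that unfolding eq[of i] by (auto elim!: set_plus_elim)
  show "j = j' \<and> d = d' \<and> x = x'"
    if "d \<in> \<D> i j" "x \<in> \<Lambda> j" "d' \<in> \<D> i j'" "x' \<in> \<Lambda> j'" "Q x + d = Q x' + d'"
    for i j j' d d' x x'
  proof -
    have "d + Q x \<in> d +o Q ` \<Lambda> j" "d' + Q x' \<in> d' +o Q ` \<Lambda> j'"
      using that(2,4) by blast+
    then have "Q x + d \<in> (d +o Q ` \<Lambda> j) \<inter> (d' +o Q ` \<Lambda> j')"
      using that(5) by (simp add: add.commute)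
    then have "(j, d) = (j', d')"
      using disj[of i] that(1,3) unfolding disjoint_family_on_def by fastforce
    with that(5) inj show ?thesis by (auto dest: injD)
  qed
qed

lemma decomposition_id:
  "decomposition id (\<lambda>i j. if i = j then {0} else {}) \<Lambda>"
  by (rule decompositionI) (auto split: if_splits)

text \<open>Expanding \<open>x\<close> further inside \<open>R x + d\<close> produces the digits
  \<open>R e + d\<close>. Uniqueness follows by reading off the outer digit first and then the inner
  one.\<close>

lemma decomposition_compose:
  assumes R: "decomposition R E \<Lambda>" and Q: "decomposition Q D \<Lambda>" and lin: "linear R"
  shows "decomposition (R \<circ> Q) (\<lambda>i k. \<Union>j. \<Union>d\<in>E i j. (\<lambda>e. R e + d) ` D j k) \<Lambda>"
proof (rule decompositionI)
  show "finite (\<Union>j. \<Union>d\<in>E i j. (\<lambda>e. R e + d) ` D j k)" for i k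
    using R Q by (auto simp: decomposition_finite)
  have split: "(R \<circ> Q) x + (R e + d) = R (Q x + e) + d" for x e d
    by (simp add: linear_add[OF lin])
  show "(R \<circ> Q) x + c \<in> \<Lambda> i" if "c \<in> (\<Union>j. \<Union>d\<in>E i j. (\<lambda>e. R e + d) ` D j k)" "x \<in> \<Lambda> k" for i k c x
  proof -
    from that(1) obtain j d e where "d \<in> E i j" "e \<in> D j k" "c = R e + d" by blast
    then show ?thesis
      using decomposition_mem[OF R] decomposition_mem[OF Q _ that(2)] split by metis
  qed
  show "\<exists>k. \<exists>c\<in>(\<Union>j. \<Union>d\<in>E i j. (\<lambda>e. R e + d) ` D j k). \<exists>x\<in>\<Lambda> k. z = (R \<circ> Q) x + c"
    if "z \<in> \<Lambda> i" for i z
  proof -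
    obtain j d y where 1: "d \<in> E i j" "y \<in> \<Lambda> j" "z = R y + d"
      by (rule decomposition_cases[OF R \<open>z \<in> \<Lambda> i\<close>]) blast
    obtain k e x where 2: "e \<in> D j k" "x \<in> \<Lambda> k" "y = Q x + e"
      by (rule decomposition_cases[OF Q 1(2)]) blast
    have "z = (R \<circ> Q) x + (R e + d)" unfolding split using 1 2 by simp
    with 1 2 show ?thesis by blast
  qed
  show "k = k' \<and> c = c' \<and> x = x'"
    if c: "c \<in> (\<Union>j. \<Union>d\<in>E i j. (\<lambda>e. R e + d) ` D j k)" and x: "x \<in> \<Lambda> k"
      and c': "c' \<in> (\<Union>j. \<Union>d\<in>E i j. (\<lambda>e. R e + d) ` D j k')" and x': "x' \<in> \<Lambda> k'"
      and eq: "(R \<circ> Q) x + c = (R \<circ> Q) x' + c'"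
    for i k k' c c' x x'
  proof -
    from c obtain j d e where 1: "d \<in> E i j" "e \<in> D j k" "c = R e + d" by blast
    from c' obtain j' d' e' where 2: "d' \<in> E i j'" "e' \<in> D j' k'" "c' = R e' + d'" by blast
    have "R (Q x + e) + d = R (Q x' + e') + d'"
      using eq unfolding 1 2 split .
    then have *: "j = j' \<and> d = d' \<and> Q x + e = Q x' + e'"
      using decomposition_unique[OF R 1(1) _ 2(1)] decomposition_mem[OF Q 1(2) x]
        decomposition_mem[OF Q 2(2) x'] by blast
    then have "k = k' \<and> e = e' \<and> x = x'"
      using decomposition_unique[OF Q _ x _ x'] 1(2) 2(2) by blast
    with * 1 2 show ?thesis by blast
  qed
qed

lemma decomposition_power:
  assumes "decomposition Q D \<Lambda>" "linear Q"
  shows "\<exists>E. decomposition (Q ^^ m) E \<Lambda>"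
proof (induction m)
  case 0
  show ?case unfolding funpow.simps(1) using decomposition_id by blast
next
  case (Suc m)
  then show ?case unfolding funpow.simps(2) using decomposition_compose[OF assms(1) _ assms(2)] by blast
qed

section \<open>Point counts\<close>

text \<open>Each coordinate differs by less than \<open>s\<close>, and the Euclidean norm is at most
  the sum of the absolute coordinates; this crude comparison is the source of the factor
  \<open>CARD('n)\<close> throughout.\<close>

lemma dist_less_if_same_cell:
  fixes x y :: "real ^ 'n::finite" and s :: real
  assumes "0 < s" "\<And>k. \<lfloor>x $ k / s\<rfloor> = \<lfloor>y $ k / s\<rfloor>"
  shows "dist x y < CARD('n) * s"
proof -
  have "\<bar>(x - y) $ k\<bar> < s" for k
  proof -
    have "\<bar>x $ k / s - y $ k / s\<bar> < 1"
      using assms(2)[of k] by linarith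
    then have "\<bar>(x $ k - y $ k) / s\<bar> < 1" by (simp add: diff_divide_distrib)
    then show ?thesis using assms(1) by (simp add: abs_divide)
  qed
  then have "(\<Sum>k\<in>UNIV. \<bar>(x - y) $ k\<bar>) < (\<Sum>k\<in>(UNIV :: 'n set). s)"
    by (intro sum_strict_mono) auto
  with norm_le_l1_cart[of "x - y"] show ?thesis by (simp add: dist_norm)
qed

lemma uniform_discreteE:
  fixes S :: "'a::metric_space set"
  assumes "uniform_discrete S"
  obtains a where "0 < a" "\<And>x y. x \<in> S \<Longrightarrow> y \<in> S \<Longrightarrow> dist x y < a \<Longrightarrow> x = y"
  using assms unfolding uniform_discrete_def by blast

lemma relatively_denseE:
  fixes S :: "(real ^ 'n::finite) set"
  assumes "relatively_dense S"
  obtains r where "0 < r" "\<And>y. \<exists>x\<in>S. dist x y \<le> r"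
proof -
  obtain r where r: "0 < r" "S + cball 0 r = UNIV" using assms unfolding relatively_dense_def by blast
  have "\<exists>x\<in>S. dist x y \<le> r" for y
  proof -
    have "y \<in> S + cball 0 r" using r(2) by simp
    then obtain x b where "x \<in> S" "norm b \<le> r" "y = x + b" by (auto elim!: set_plus_elim)
    then show ?thesis by (intro bexI[of _ x]) (auto simp: dist_norm)
  qed
  with r(1) that show ?thesis by blast
qed

text \<open>Cells of side \<open>a / CARD('n)\<close> hold at most one point each, and the ball
  meets boundedly many of them. Indexing the cells relative to \<open>p\<close> makes the bound
  independent of \<open>p\<close>.\<close>

lemma uniform_discrete_card_bounded:
  fixes S :: "(real ^ 'n::finite) set"
  assumes "uniform_discrete S"
  shows "\<exists>K. \<forall>p. finite {x \<in> S. dist x p \<le> r} \<and> card {x \<in> S. dist x p \<le> r} \<le> K"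
proof -
  obtain a where a: "0 < a" "\<And>x y. x \<in> S \<Longrightarrow> y \<in> S \<Longrightarrow> dist x y < a \<Longrightarrow> x = y"
    by (rule uniform_discreteE[OF assms]) blast
  define s where "s = a / CARD('n)"
  have s: "0 < s" using a(1) by (simp add: s_def)
  define N where "N = \<lceil>r / s\<rceil> + 1"
  define f where "f p x = (\<lambda>k. \<lfloor>(x - p) $ k / s\<rfloor>)" for p x :: "real ^ 'n"
  let ?T = "PiE UNIV (\<lambda>_ :: 'n. {- N..N})"
  have fin: "finite ?T" by (intro finite_PiE) auto
  have inj: "inj_on (f p) {x \<in> S. dist x p \<le> r}" for p
  proof (rule inj_onI)
    fix x y assume "x \<in> {x \<in> S. dist x p \<le> r}" "y \<in> {x \<in> S. dist x p \<le> r}" "f p x = f p y"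
    moreover from this have "dist (x - p) (y - p) < CARD('n) * s"
      using s by (intro dist_less_if_same_cell) (auto simp: f_def dest: fun_cong)
    ultimately show "x = y" using a(2) by (simp add: s_def dist_norm)
  qed
  have sub: "f p ` {x \<in> S. dist x p \<le> r} \<subseteq> ?T" for p
  proof (intro subsetI)
    fix w assume "w \<in> f p ` {x \<in> S. dist x p \<le> r}"
    then obtain x where x: "dist x p \<le> r" "w = f p x" by blast
    have "w k \<in> {- N..N}" for k
    proof -
      have "\<bar>(x - p) $ k\<bar> \<le> r" using component_le_norm_cart[of "x - p" k] x(1) by (simp add: dist_norm)
      then have "\<bar>(x - p) $ k / s\<bar> \<le> r / s" using s by (simp add: abs_divide divide_right_mono)
      then show ?thesis unfolding x(2) f_def N_def atLeastAtMost_iff by (intro conjI; linarith)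
    qed
    then show "w \<in> ?T" by auto
  qed
  have "finite {x \<in> S. dist x p \<le> r} \<and> card {x \<in> S. dist x p \<le> r} \<le> card ?T" for p
    using inj_on_finite[OF inj sub fin] card_inj_on_le[OF inj sub fin] by blast
  then show ?thesis by blast
qed

lemma relatively_dense_infinite:
  fixes S :: "(real ^ 'n::finite) set"
  assumes "relatively_dense S"
  shows "infinite S"
proof
  assume "finite S"
  then obtain b where b: "\<And>x. x \<in> S \<Longrightarrow> norm x \<le> b"
    using finite_imp_bounded bounded_iff by metis
  obtain r where r: "0 < r" "\<And>y. \<exists>x\<in>S. dist x y \<le> r"
    by (rule relatively_denseE[OF assms]) blast
  define y :: "real ^ 'n" where "y = (b + r + 1) *\<^sub>R axis undefined 1"
  obtain x where "x \<in> S" "dist x y \<le> r" using r(2) by blast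
  with b have "norm y \<le> b + r"
    using norm_triangle_ineq2[of y x] by (force simp: dist_norm norm_minus_commute)
  moreover have "norm y = \<bar>b + r + 1\<bar>" by (simp add: y_def norm_axis_1)
  ultimately show False by linarith
qed

section \<open>Return vectors\<close>

lemma expansive_linear_power:
  assumes "expansive Q"
  shows "linear (Q ^^ m)"
proof (induction m)
  case 0
  show ?case unfolding funpow.simps(1) by (rule linear_id)
next
  case (Suc m)
  have "linear Q" using assms by (simp add: expansive_def)
  with Suc show ?case unfolding funpow.simps(2) by (rule linear_compose)
qed

text \<open>
  If all digit sets of level \<open>m\<close> had at most one element, then among any \<open>\<kappa> + 1\<close> points of \<open>\<Lambda>\<^sub>i\<close> two
  would differ by an element of \<open>Q\<^sup>m (\<Lambda>\<^sub>j - \<Lambda>\<^sub>j)\<close>, which has no short non-zero vectors for large \<open>m\<close>.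
\<close>

lemma exists_repeated_digit:
  fixes \<Lambda> :: "'k::finite \<Rightarrow> (real ^ 'n::finite) set"
  assumes exp: "expansive Q" and dec: "decomposition Q D \<Lambda>"
    and ud: "\<And>j. uniform_discrete (\<Lambda> j)" and inf: "infinite (\<Lambda> i)"
  shows "\<exists>m E j d d'. decomposition (Q ^^ m) E \<Lambda> \<and> d \<in> E i j \<and> d' \<in> E i j \<and> d \<noteq> d'"
proof -
  have lin: "linear Q" using exp by (simp add: expansive_def)
  have bij: "bij Q" by (rule expansive_bij[OF exp])
  obtain a where a: "\<And>j. 0 < a j" "\<And>j x y. x \<in> \<Lambda> j \<Longrightarrow> y \<in> \<Lambda> j \<Longrightarrow> dist x y < a j \<Longrightarrow> x = y"
    using ud unfolding uniform_discrete_def by metis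
  obtain F where F: "F \<subseteq> \<Lambda> i" "finite F" "card F = Suc (CARD('k))"
    using infinite_arbitrarily_large[OF inf] by metis
  have "\<forall>\<^sub>F m in sequentially. norm ((inv Q ^^ m) (p - q)) < a j" for p q j
    using order_tendstoD(2)[OF tendsto_norm_zero[OF expansive_inv_powers_tendsto_0[OF exp]] a(1)] .
  then have "\<forall>\<^sub>F m in sequentially. \<forall>p\<in>F. \<forall>q\<in>F. \<forall>j\<in>UNIV. norm ((inv Q ^^ m) (p - q)) < a j"
    using F(2) by (intro eventually_ball_finite ballI) auto
  then obtain m where m: "\<And>p q j. p \<in> F \<Longrightarrow> q \<in> F \<Longrightarrow> norm ((inv Q ^^ m) (p - q)) < a j"
    unfolding eventually_sequentially by blast
  obtain E where E: "decomposition (Q ^^ m) E \<Lambda>" using decomposition_power[OF dec lin] by blast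
  have "\<forall>z\<in>F. \<exists>j d x. d \<in> E i j \<and> x \<in> \<Lambda> j \<and> z = (Q ^^ m) x + d"
    using F(1) decomposition_cases[OF E] by (metis subsetD)
  then obtain c d x where z: "\<And>z. z \<in> F \<Longrightarrow> d z \<in> E i (c z)" "\<And>z. z \<in> F \<Longrightarrow> x z \<in> \<Lambda> (c z)"
      "\<And>z. z \<in> F \<Longrightarrow> z = (Q ^^ m) (x z) + d z"
    by metis
  have "\<not> inj_on c F"
  proof
    assume "inj_on c F"
    then have "card F \<le> CARD('k)" by (intro card_inj_on_le) auto
    with F(3) show False by simp
  qed
  then obtain p q where pq: "p \<in> F" "q \<in> F" "p \<noteq> q" "c p = c q" by (auto simp: inj_on_def)
  have "d p \<noteq> d q"
  proof
    assume eq: "d p = d q"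
    have "p - q = (Q ^^ m) (x p) - (Q ^^ m) (x q)"
      using arg_cong2[OF z(3)[OF pq(1)] z(3)[OF pq(2)], of minus] eq by simp
    then have "p - q = (Q ^^ m) (x p - x q)"
      by (simp add: linear_diff[OF expansive_linear_power[OF exp]])
    then have "(inv Q ^^ m) (p - q) = x p - x q"
      by (simp add: inv_fn[OF bij, symmetric] bij_fn[OF bij] bij_is_inj)
    then have "dist (x p) (x q) < a (c p)" using m[OF pq(1,2)] by (simp add: dist_norm)
    then have "x p = x q" using a(2) z(2) pq by metis
    with eq z(3) pq show False by metis
  qed
  then show ?thesis using E z(1) pq by metis
qed

text \<open>For two digits \<open>d\<close>, \<open>d'\<close> of the same piece, every
  \<open>x\<close> in \<open>\<Lambda> j\<close> yields two points of \<open>\<Lambda> i\<close>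
  that differ by the fixed vector \<open>d' - d\<close>. These points are relatively dense because a
  linear bijection preserves relative density.\<close>

lemma exists_return_vector:
  fixes \<Lambda> :: "'k::finite \<Rightarrow> (real ^ 'n::finite) set"
  assumes exp: "expansive Q" and dec: "decomposition Q D \<Lambda>"
    and ud: "\<And>j. uniform_discrete (\<Lambda> j)" and rd: "\<And>j. relatively_dense (\<Lambda> j)"
  shows "\<exists>v r. v \<noteq> 0 \<and> (\<forall>y. \<exists>x\<in>\<Lambda> i. x + v \<in> \<Lambda> i \<and> dist x y \<le> r)"
proof -
  obtain m E j d d' where E: "decomposition (Q ^^ m) E \<Lambda>" and d: "d \<in> E i j" "d' \<in> E i j" "d \<noteq> d'"
    using exists_repeated_digit[OF exp dec ud relatively_dense_infinite[OF rd]] by blast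
  let ?R = "Q ^^ m"
  have lin: "linear ?R" by (rule expansive_linear_power[OF exp])
  have bij: "bij ?R" using expansive_bij[OF exp] by (rule bij_fn)
  obtain b where b: "\<And>x. norm (?R x) \<le> b * norm x" "0 < b"
    using linear_bounded_pos[OF lin] by blast
  obtain r where r: "0 < r" "\<And>y. \<exists>x\<in>\<Lambda> j. dist x y \<le> r"
    by (rule relatively_denseE[OF rd[of j]]) blast
  have "\<exists>x\<in>\<Lambda> i. x + (d' - d) \<in> \<Lambda> i \<and> dist x y \<le> b * r" for y
  proof -
    obtain x where x: "x \<in> \<Lambda> j" "dist x (inv ?R (y - d)) \<le> r" using r(2) by blast
    have "?R x + d - y = ?R (x - inv ?R (y - d))"
      using bij by (simp add: linear_diff[OF lin] bij_is_surj surj_f_inv_f)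
    then have "dist (?R x + d) y \<le> b * norm (x - inv ?R (y - d))"
      using b(1) by (simp add: dist_norm)
    also have "\<dots> \<le> b * r" using x(2) b(2) by (simp add: dist_norm)
    finally have "dist (?R x + d) y \<le> b * r" .
    moreover have "?R x + d \<in> \<Lambda> i" "?R x + d + (d' - d) \<in> \<Lambda> i"
      using decomposition_mem[OF E d(1) x(1)] decomposition_mem[OF E d(2) x(1)] by simp_all
    ultimately show ?thesis by blast
  qed
  moreover have "d' - d \<noteq> 0" using d(3) by simp
  ultimately show ?thesis by blast
qed

text \<open>
  This replaces a density computation: taking \<open>i\<close> with the largest digit set \<open>E j i\<close>, each \<open>E j i'\<close>
  injects into \<open>E j i\<close> by some \<open>\<iota>\<close>, and \<open>R x + d \<mapsto> R (\<sigma> x) + \<iota> d\<close> moves points boundedly. The bound on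
  its fibres does not involve \<open>R\<close>; the bound \<open>\<rho>\<close> on the displacement may.
\<close>

lemma exists_map_to_returning_points:
  fixes \<Lambda> :: "'k::finite \<Rightarrow> (real ^ 'n::finite) set"
  assumes E: "decomposition R E \<Lambda>" and lin: "linear R"
    and \<sigma>: "\<And>i y. \<sigma> i y \<in> \<Lambda> i" "\<And>i y. \<sigma> i y + v i \<in> \<Lambda> i" "\<And>i y. dist (\<sigma> i y) y \<le> r"
    and K: "\<And>i p. finite {x \<in> \<Lambda> i. dist x p \<le> r}" "\<And>i p. card {x \<in> \<Lambda> i. dist x p \<le> r} \<le> K"
  shows "\<exists>i \<rho> \<phi>. (\<forall>z\<in>\<Lambda> j. \<phi> z \<in> \<Lambda> j \<and> \<phi> z + R (v i) \<in> \<Lambda> j \<and> dist (\<phi> z) z \<le> \<rho>) \<and>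
    (\<forall>p. finite {z \<in> \<Lambda> j. \<phi> z = p} \<and> card {z \<in> \<Lambda> j. \<phi> z = p} \<le> CARD('k) * K)"
proof -
  obtain i0 where i0: "\<And>i. card (E j i) \<le> card (E j i0)"
  proof -
    let ?c = "\<lambda>i. card (E j i)"
    have "Max (range ?c) \<in> range ?c" by (intro Max_in) auto
    then obtain i0 where "Max (range ?c) = ?c i0" by blast
    moreover have "?c i \<le> Max (range ?c)" for i by (intro Max_ge) auto
    ultimately show thesis by (intro that[of i0]) simp
  qed
  have "\<exists>f. f ` E j i \<subseteq> E j i0 \<and> inj_on f (E j i)" for i
    using card_le_inj[OF decomposition_finite[OF E] decomposition_finite[OF E] i0] by blast
  then obtain \<iota> where \<iota>: "\<And>i. \<iota> i ` E j i \<subseteq> E j i0" "\<And>i. inj_on (\<iota> i) (E j i)" by metis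
  have "\<forall>z\<in>\<Lambda> j. \<exists>i d x. d \<in> E j i \<and> x \<in> \<Lambda> i \<and> z = R x + d"
    using decomposition_cases[OF E] by metis
  then obtain c d x where z: "\<And>z. z \<in> \<Lambda> j \<Longrightarrow> d z \<in> E j (c z)" "\<And>z. z \<in> \<Lambda> j \<Longrightarrow> x z \<in> \<Lambda> (c z)"
      "\<And>z. z \<in> \<Lambda> j \<Longrightarrow> z = R (x z) + d z"
    by metis
  define \<phi> where "\<phi> z = R (\<sigma> i0 (x z)) + \<iota> (c z) (d z)" for z
  have \<iota>d: "\<iota> (c z) (d z) \<in> E j i0" if "z \<in> \<Lambda> j" for z
    using \<iota>(1) z(1)[OF that] by blast
  have \<phi>1: "\<phi> z \<in> \<Lambda> j" if "z \<in> \<Lambda> j" for z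
    unfolding \<phi>_def by (rule decomposition_mem[OF E \<iota>d[OF that] \<sigma>(1)])
  have \<phi>2: "\<phi> z + R (v i0) \<in> \<Lambda> j" if "z \<in> \<Lambda> j" for z
    using decomposition_mem[OF E \<iota>d[OF that] \<sigma>(2)] by (simp add: \<phi>_def linear_add[OF lin] algebra_simps)
  obtain b where b: "\<And>x. norm (R x) \<le> b * norm x" "0 < b"
    using linear_bounded_pos[OF lin] by blast
  have "finite (\<Union>i. E j i)" by (intro finite_UN_I decomposition_finite[OF E]) auto
  then obtain M where M: "\<And>i e. e \<in> E j i \<Longrightarrow> norm e \<le> M"
    using finite_imp_bounded bounded_iff by (metis UN_I UNIV_I)
  have \<phi>3: "dist (\<phi> z) z \<le> b * r + 2 * M" if "z \<in> \<Lambda> j" for z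
  proof -
    have "\<phi> z - z = R (\<sigma> i0 (x z) - x z) + (\<iota> (c z) (d z) - d z)"
      using z(3)[OF that] by (simp add: \<phi>_def linear_diff[OF lin] algebra_simps)
    then have "dist (\<phi> z) z \<le> norm (R (\<sigma> i0 (x z) - x z)) + norm (\<iota> (c z) (d z) - d z)"
      by (simp add: dist_norm norm_triangle_ineq)
    moreover have "norm (R (\<sigma> i0 (x z) - x z)) \<le> b * r"
      using b(1)[of "\<sigma> i0 (x z) - x z"] mult_left_mono[OF \<sigma>(3)[of i0 "x z"], of b] b(2)
      unfolding dist_norm by linarith
    moreover have "norm (\<iota> (c z) (d z) - d z) \<le> M + M"
      using norm_triangle_ineq4[of "\<iota> (c z) (d z)" "d z"] M[OF \<iota>d[OF that]] M[OF z(1)[OF that]] by linarith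
    ultimately show ?thesis by linarith
  qed
  have fib: "finite {z \<in> \<Lambda> j. \<phi> z = p} \<and> card {z \<in> \<Lambda> j. \<phi> z = p} \<le> CARD('k) * K" for p
  proof (cases "{z \<in> \<Lambda> j. \<phi> z = p} = {}")
    case True
    then show ?thesis by (metis card.empty finite.emptyI le0)
  next
    case False
    then obtain z0 where z0: "z0 \<in> \<Lambda> j" "\<phi> z0 = p" by blast
    define s where "s = \<sigma> i0 (x z0)"
    define e where "e = \<iota> (c z0) (d z0)"
    \<comment> \<open>The value \<open>p = R s + e\<close> has a unique expansion, so a point
      \<open>w\<close> of the fibre is recovered from the colour \<open>c w\<close> and the point
      \<open>x w\<close>, which lies within \<open>r\<close> of \<open>s\<close>. This leaves at
      most \<open>K\<close> choices for each colour.\<close>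
    let ?U = "\<lambda>i. (\<lambda>x. R x + inv_into (E j i) (\<iota> i) e) ` {x \<in> \<Lambda> i. dist x s \<le> r}"
    have sub: "{z \<in> \<Lambda> j. \<phi> z = p} \<subseteq> (\<Union>i. ?U i)"
    proof (intro subsetI, elim CollectE conjE)
      fix w assume w: "w \<in> \<Lambda> j" "\<phi> w = p"
      have "R (\<sigma> i0 (x w)) + \<iota> (c w) (d w) = R s + e"
        using w(2) z0(2) unfolding \<phi>_def s_def e_def by simp
      then have *: "\<iota> (c w) (d w) = e" "\<sigma> i0 (x w) = s"
        using decomposition_unique[OF E \<iota>d[OF w(1)] \<sigma>(1) \<iota>d[OF z0(1)] \<sigma>(1)] unfolding s_def e_def by blast+
      have "d w = inv_into (E j (c w)) (\<iota> (c w)) e"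
        using \<iota>(2) z(1)[OF w(1)] *(1) by (metis inv_into_f_f)
      moreover have "dist (x w) s \<le> r" using \<sigma>(3)[of i0 "x w"] *(2) by (simp add: dist_commute)
      ultimately have "w \<in> ?U (c w)"
        using z(2,3)[OF w(1)] by (metis (mono_tags, lifting) image_eqI mem_Collect_eq)
      then show "w \<in> (\<Union>i. ?U i)" by blast
    qed
    have fin: "finite (?U i)" for i using K(1) by blast
    have "card (?U i) \<le> K" for i
      using card_image_le[OF K(1)] K(2) order_trans by blast
    then have "card (\<Union>i. ?U i) \<le> (\<Sum>i\<in>(UNIV :: 'k set). K)"
      by (intro order_trans[OF card_UN_le] sum_mono) auto
    then have "card (\<Union>i. ?U i) \<le> CARD('k) * K" by simp
    moreover have "finite (\<Union>i. ?U i)" by (intro finite_UN_I fin) auto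
    ultimately show ?thesis using sub by (meson card_mono finite_subset order_trans)
  qed
  show ?thesis using \<phi>1 \<phi>2 \<phi>3 fib by blast
qed

section \<open>Counting the cells of a window that contain a returning point\<close>

lemma card_le_mult_card_image:
  assumes "finite A" "\<And>y. y \<in> f ` A \<Longrightarrow> card {x \<in> A. f x = y} \<le> K"
  shows "card A \<le> K * card (f ` A)"
proof -
  have "card A = card (\<Union>y\<in>f ` A. {x \<in> A. f x = y})" by (intro arg_cong[of _ _ card]) blast
  also have "\<dots> \<le> (\<Sum>y\<in>f ` A. card {x \<in> A. f x = y})" using assms(1) by (intro card_UN_le) auto
  also have "\<dots> \<le> of_nat (card (f ` A)) * K" using assms(2) by (intro sum_bounded_above)
  finally show ?thesis by (simp add: mult.commute)
qed

text \<open>A cube of side \<open>L > 2 * r\<close> contains a point of \<open>S\<close> near its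
  centre. Moving the points chosen in \<open>m ^ CARD('n)\<close> cubes by \<open>\<phi>\<close>
  yields returning points in a slightly larger window, and at most \<open>K\<close> cubes lead to
  the same point. Each cube is split into \<open>l ^ CARD('n)\<close> cells, small enough to hold
  one point each, so distinct returning points occupy distinct cells.\<close>

lemma card_returning_cells:
  fixes S :: "(real ^ 'n::finite) set" and a r s L \<rho> :: real and l m N K :: nat
  assumes dense: "\<And>y. \<exists>x\<in>S. dist x y \<le> r"
    and sep: "\<And>x y. x \<in> S \<Longrightarrow> y \<in> S \<Longrightarrow> dist x y < a \<Longrightarrow> x = y"
    and \<phi>: "\<And>z. z \<in> S \<Longrightarrow> \<phi> z \<in> S" "\<And>z. z \<in> S \<Longrightarrow> \<phi> z + g \<in> S"
      "\<And>z. z \<in> S \<Longrightarrow> dist (\<phi> z) z \<le> \<rho>"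
    and K: "\<And>p. finite {z \<in> S. \<phi> z = p}" "\<And>p. card {z \<in> S. \<phi> z = p} \<le> K"
    and L: "2 * r < L" "0 < L" and l: "0 < l" and s: "s = L / l" "CARD('n) * s \<le> a" and N: "\<rho> \<le> N * L"
  shows "m ^ CARD('n) \<le> K * card {w \<in> UNIV \<rightarrow>\<^sub>E {0..<int ((m + 2 * N) * l)}.
    \<exists>z\<in>S. z + g \<in> S \<and> (\<forall>k. \<lfloor>(z - c) $ k / s\<rfloor> = w k)}"
    (is "_ \<le> K * card ?W")
proof -
  let ?U = "(UNIV :: 'n set) \<rightarrow>\<^sub>E {0..<int m}"
  have s0: "0 < s" using L l s by simp
  have finU: "finite ?U" by (intro finite_PiE) auto
  have cardU: "card ?U = m ^ CARD('n)" by (simp add: card_PiE)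
  \<comment> \<open>The targets are the cube centres. The offset \<open>N\<close> leaves a margin of
    \<open>N * L\<close>, at least the displacement \<open>\<rho>\<close>, around the block of
    cubes.\<close>
  have "\<forall>u. \<exists>z\<in>S. dist z (c + (\<chi> k. L * (N + of_int (u k) + 1 / 2))) \<le> r"
    using dense by blast
  then obtain z where z: "\<And>u. z u \<in> S" "\<And>u. dist (z u) (c + (\<chi> k. L * (N + of_int (u k) + 1 / 2))) \<le> r"
    by metis
  have zk: "L * (N + of_int (u k)) < (z u - c) $ k" "(z u - c) $ k < L * (N + of_int (u k) + 1)"
    for u :: "'n \<Rightarrow> int" and k
  proof -
    have "\<bar>(z u - (c + (\<chi> k. L * (N + of_int (u k) + 1 / 2)))) $ k\<bar> \<le> r"
      using component_le_norm_cart z(2)[of u] unfolding dist_norm by (rule order_trans)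
    then have "\<bar>(z u - c) $ k - L * (N + of_int (u k) + 1 / 2)\<bar> < L / 2"
      using L(1) by (simp add: diff_diff_eq)
    then show "L * (N + of_int (u k)) < (z u - c) $ k" "(z u - c) $ k < L * (N + of_int (u k) + 1)"
      unfolding abs_less_iff by (simp_all add: algebra_simps)
  qed
  have injz: "u = u'" if "z u = z u'" for u u' :: "'n \<Rightarrow> int"
  proof
    fix k
    have "L * (N + of_int (u k)) < L * (N + of_int (u' k) + 1)"
      using zk(1)[of u k] zk(2)[of u' k] that by simp
    moreover have "L * (N + of_int (u' k)) < L * (N + of_int (u k) + 1)"
      using zk(1)[of u' k] zk(2)[of u k] that by simp
    ultimately have "real_of_int (u k) < of_int (u' k) + 1" "real_of_int (u' k) < of_int (u k) + 1"
      using L(2) by simp_all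
    then show "u k = u' k" by linarith
  qed
  define h where "h u = (\<lambda>k. \<lfloor>(\<phi> (z u) - c) $ k / s\<rfloor>)" for u
  have sub: "h ` ?U \<subseteq> ?W"
  proof (intro subsetI, elim imageE)
    fix w u assume u: "u \<in> ?U" and w: "w = h u"
    have "w k \<in> {0..<int ((m + 2 * N) * l)}" for k
    proof -
      have "\<bar>(\<phi> (z u) - z u) $ k\<bar> \<le> N * L"
        using component_le_norm_cart[of "\<phi> (z u) - z u" k] \<phi>(3)[OF z(1), of u] N
        unfolding dist_norm by linarith
      then have d: "\<bar>(\<phi> (z u) - c) $ k - (z u - c) $ k\<bar> \<le> N * L" by simp
      have uk: "0 \<le> u k" "u k + 1 \<le> int m" using PiE_mem[OF u, of k] by simp_all
      have "0 \<le> L * of_int (u k)" using L(2) uk(1) by simp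
      then have lo: "0 \<le> (\<phi> (z u) - c) $ k"
        using d zk(1)[of u k] by (simp add: algebra_simps abs_le_iff)
      have "of_int (u k) + 1 \<le> real m" using uk(2) by linarith
      then have "L * (of_int (u k) + 1) \<le> L * m" using L(2) by simp
      then have "(\<phi> (z u) - c) $ k < L * (m + 2 * N)"
        using d zk(2)[of u k] by (simp add: algebra_simps abs_le_iff)
      then have "(\<phi> (z u) - c) $ k / s < L * (m + 2 * N) / s"
        using s0 by (rule divide_strict_right_mono)
      also have "\<dots> = (m + 2 * N) * l" using L(2) l unfolding s(1) by simp
      finally have "(\<phi> (z u) - c) $ k / s < (m + 2 * N) * l" .
      moreover have "0 \<le> (\<phi> (z u) - c) $ k / s" using lo s0 by simp
      ultimately show ?thesis unfolding w h_def atLeastLessThan_iff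
        by (simp only: zero_le_floor floor_less_iff of_int_of_nat_eq)
    qed
    then show "w \<in> ?W"
      unfolding mem_Collect_eq by (intro conjI bexI[of _ "\<phi> (z u)"]) (auto simp: w h_def \<phi> z(1))
  qed
  \<comment> \<open>Two cubes sent to the same cell have the same value of \<open>\<phi>\<close>, so
    they inject into one fibre of \<open>\<phi>\<close>.\<close>
  have "card ?U \<le> K * card (h ` ?U)"
  proof (rule card_le_mult_card_image[OF finU])
    fix y assume "y \<in> h ` ?U"
    then obtain u0 where u0: "y = h u0" by blast
    have "z ` {u \<in> ?U. h u = y} \<subseteq> {x \<in> S. \<phi> x = \<phi> (z u0)}"
    proof (intro subsetI, elim imageE CollectE conjE)
      fix x u assume u: "x = z u" "h u = y"
      have "dist (\<phi> (z u) - c) (\<phi> (z u0) - c) < CARD('n) * s"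
        by (rule dist_less_if_same_cell[OF s0]) (use u(2) u0 in \<open>metis h_def\<close>)
      then have "\<phi> (z u) = \<phi> (z u0)" using s(2) by (intro sep \<phi> z) (simp add: dist_norm)
      then show "x \<in> {x \<in> S. \<phi> x = \<phi> (z u0)}" using u(1) z(1) by simp
    qed
    moreover have "inj_on z {u \<in> ?U. h u = y}" using injz by (auto simp: inj_on_def)
    ultimately have "card {u \<in> ?U. h u = y} \<le> card {x \<in> S. \<phi> x = \<phi> (z u0)}"
      using K(1) by (intro card_inj_on_le)
    then show "card {u \<in> ?U. h u = y} \<le> K" using K(2) order_trans by blast
  qed
  moreover have "finite ?W"
    by (rule finite_subset[of _ "UNIV \<rightarrow>\<^sub>E {0..<int ((m + 2 * N) * l)}"], blast,
        intro finite_PiE, auto)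
  then have "card (h ` ?U) \<le> card ?W" using sub by (rule card_mono)
  ultimately show ?thesis unfolding cardU by (meson mult_le_mono2 order_trans)
qed

section \<open>The orbit closure\<close>

lemma orbit_closure_approx:
  assumes "\<Gamma> \<in> orbit_closure \<Lambda>" "0 < e"
  shows "\<exists>g \<epsilon>. 0 < \<epsilon> \<and> \<epsilon> < e \<and> kset_close \<epsilon> \<Gamma> (translate g \<Lambda>)"
proof -
  interpret Metric_space "Collect delone_kset" kset_dist by (rule Metric_space_delone_ksets)
  \<comment> \<open>The cap at \<open>1 / sqrt 2\<close> excludes the element of the infimum set
    that carries no closeness.\<close>
  define e' where "e' = min e (1 / sqrt 2)"
  have e': "0 < e'" using assms(2) by (simp add: e'_def)
  have "\<Gamma> \<in> mtopology closure_of (range (\<lambda>g. translate g \<Lambda>))"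
    using assms(1) by (simp add: orbit_closure_def kset_topology_def)
  then obtain g where "kset_dist \<Gamma> (translate g \<Lambda>) < e'"
    using e' unfolding metric_closure_of by (auto simp: in_mball)
  then obtain \<epsilon> where "\<epsilon> \<in> insert (1 / sqrt 2) {\<epsilon>. 0 < \<epsilon> \<and> kset_close \<epsilon> \<Gamma> (translate g \<Lambda>)}" "\<epsilon> < e'"
    unfolding kset_dist_def by (meson cInf_lessD insert_not_empty)
  then have "0 < \<epsilon> \<and> \<epsilon> < e \<and> kset_close \<epsilon> \<Gamma> (translate g \<Lambda>)" by (auto simp: e'_def)
  then show ?thesis by blast
qed

lemma orbit_closure_subset: "orbit_closure \<Lambda> \<subseteq> Collect delone_kset"
proof -
  interpret Metric_space "Collect delone_kset" kset_dist by (rule Metric_space_delone_ksets)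
  show ?thesis
    using closure_of_subset_topspace[of mtopology]
    by (simp add: orbit_closure_def kset_topology_def)
qed

lemma kset_closeD1:
  assumes "kset_close \<epsilon> \<Gamma> \<Gamma>'" "z \<in> \<Gamma>' j" "norm z < 1 / \<epsilon>"
  shows "\<exists>y\<in>\<Gamma> j. dist y z < \<epsilon>"
proof -
  have "z \<in> ball 0 (1 / \<epsilon>) \<inter> \<Gamma>' j" using assms(2,3) by simp
  then have "z \<in> \<Gamma> j + ball 0 \<epsilon>" using assms(1) unfolding kset_close_def by blast
  then show ?thesis unfolding set_plus_ball_iff .
qed

lemma kset_closeD2:
  assumes "kset_close \<epsilon> \<Gamma> \<Gamma>'" "z \<in> \<Gamma> j" "norm z < 1 / \<epsilon>"
  shows "\<exists>y\<in>\<Gamma>' j. dist y z < \<epsilon>"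
  using kset_closeD1[of \<epsilon> \<Gamma>' \<Gamma>] assms kset_close_commute by blast

lemma less_inverse_if_less:
  fixes \<epsilon> b :: real
  assumes "0 < \<epsilon>" "\<epsilon> < 1 / (b + 1)" "0 \<le> b"
  shows "b < 1 / \<epsilon>"
proof -
  have "\<epsilon> * (b + 1) < 1" using assms by (simp add: pos_less_divide_eq)
  then have "\<epsilon> * b < 1" using assms(1) by (simp add: algebra_simps)
  then show ?thesis using assms(1) by (simp add: pos_less_divide_eq mult.commute)
qed

text \<open>Two distinct points of \<open>\<Gamma>\<close> at distance below \<open>a\<close> would
  be approximated by two points of a translate of \<open>\<Lambda>\<close>, still distinct and still
  closer than \<open>a\<close>.\<close>

lemma orbit_closure_separated:
  assumes sep: "\<And>x y. x \<in> \<Lambda> j \<Longrightarrow> y \<in> \<Lambda> j \<Longrightarrow> dist x y < a \<Longrightarrow> x = y"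
    and "\<Gamma> \<in> orbit_closure \<Lambda>" "z \<in> \<Gamma> j" "z' \<in> \<Gamma> j" "dist z z' < a"
  shows "z = z'"
proof (rule ccontr)
  assume ne: "z \<noteq> z'"
  define b where "b = norm z + norm z'"
  \<comment> \<open>The first bound makes both points visible in the ball of radius
    \<open>1 / \<epsilon>\<close>, the second keeps the approximating points closer than
    \<open>a\<close>, and the third keeps them distinct.\<close>
  define e where "e = min (1 / (b + 1)) (min ((a - dist z z') / 2) (dist z z' / 2))"
  have b0: "0 \<le> b" by (simp add: b_def)
  have "0 < e" using ne b0 assms(5) by (simp add: e_def)
  then obtain g \<epsilon> where \<epsilon>: "0 < \<epsilon>" "\<epsilon> < e" "kset_close \<epsilon> \<Gamma> (translate g \<Lambda>)"
    using orbit_closure_approx[OF assms(2)] by blast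
  have "b < 1 / \<epsilon>" using less_inverse_if_less[OF \<epsilon>(1) _ b0] \<epsilon>(2) by (simp add: e_def)
  then have "norm z < 1 / \<epsilon>" "norm z' < 1 / \<epsilon>"
    unfolding b_def using norm_ge_zero[of z] norm_ge_zero[of z'] by linarith+
  then obtain y y' where y: "y \<in> translate g \<Lambda> j" "dist y z < \<epsilon>" "y' \<in> translate g \<Lambda> j" "dist y' z' < \<epsilon>"
    using kset_closeD2[OF \<epsilon>(3)] assms(3,4) by metis
  have tri: "dist y y' \<le> dist y z + dist z z' + dist y' z'" "dist z z' \<le> dist y z + dist y y' + dist y' z'"
    by metric+
  have "2 * \<epsilon> < a - dist z z'" "2 * \<epsilon> < dist z z'" using \<epsilon>(2) by (simp_all add: e_def)
  with tri y(2,4) have "dist y y' < a" "0 < dist y y'" by linarith+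
  moreover obtain x x' where "x \<in> \<Lambda> j" "y = x - g" "x' \<in> \<Lambda> j" "y' = x' - g"
    using y(1,3) unfolding translate_def by blast
  ultimately show False using sep[of x x'] by (simp add: dist_norm)
qed

section \<open>The events that a point set meets a given region\<close>

definition hitting ::
  "('k::finite \<Rightarrow> (real ^ 'n::finite) set) \<Rightarrow> 'k \<Rightarrow> (real ^ 'n) set \<Rightarrow> ('k \<Rightarrow> (real ^ 'n) set) set" where
  "hitting \<Lambda> j U = {\<Gamma> \<in> orbit_closure \<Lambda>. \<Gamma> j \<inter> U \<noteq> {}}"

lemma invariant_borel_probability_space:
  assumes "invariant_borel_probability \<Lambda> \<mu>"
  shows "space \<mu> = orbit_closure \<Lambda>"
proof -
  have "{U. openin (subtopology kset_topology (orbit_closure \<Lambda>)) U} \<subseteq> Pow (orbit_closure \<Lambda>)"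
    using openin_subset by force
  then have "space (orbit_closure_borel \<Lambda>) = orbit_closure \<Lambda>"
    unfolding orbit_closure_borel_def by (rule space_measure_of)
  then show ?thesis
    using assms sets_eq_imp_space_eq unfolding invariant_borel_probability_def by metis
qed

text \<open>The event is open in the orbit closure: a point of \<open>\<Gamma> j\<close> in
  \<open>U\<close> stays in \<open>U\<close> when \<open>\<Gamma>\<close> is perturbed
  slightly.\<close>

lemma open_hitting_measurable:
  assumes \<mu>: "invariant_borel_probability \<Lambda> \<mu>" and U: "open U"
  shows "hitting \<Lambda> j U \<in> sets \<mu>"
proof -
  interpret Metric_space "Collect delone_kset" kset_dist by (rule Metric_space_delone_ksets)
  define V where "V = {\<Gamma>. delone_kset \<Gamma> \<and> \<Gamma> j \<inter> U \<noteq> {}}"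
  have "openin mtopology V"
    unfolding openin_mtopology
  proof (intro conjI allI impI)
    show "V \<subseteq> Collect delone_kset" by (auto simp: V_def)
    fix \<Gamma> assume "\<Gamma> \<in> V"
    then obtain z where z: "z \<in> \<Gamma> j" "z \<in> U" by (auto simp: V_def)
    obtain r where r: "0 < r" "ball z r \<subseteq> U" using U z(2) open_contains_ball by blast
    \<comment> \<open>The three bounds discard the cap of the metric, keep the perturbed point in
      \<open>U\<close>, and make \<open>z\<close> visible in the ball of radius
      \<open>1 / \<epsilon>\<close>.\<close>
    define e where "e = min (1 / sqrt 2) (min r (1 / (norm z + 1)))"
    have "0 < e" using r(1) by (simp add: e_def add_nonneg_pos)
    moreover have "mball \<Gamma> e \<subseteq> V"
    proof
      fix \<Gamma>' assume "\<Gamma>' \<in> mball \<Gamma> e"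
      then have G': "delone_kset \<Gamma>'" "kset_dist \<Gamma> \<Gamma>' < e" by (simp_all add: in_mball)
      then obtain \<epsilon> where "\<epsilon> \<in> insert (1 / sqrt 2) {\<epsilon>. 0 < \<epsilon> \<and> kset_close \<epsilon> \<Gamma> \<Gamma>'}" "\<epsilon> < e"
        unfolding kset_dist_def by (meson cInf_lessD insert_not_empty)
      then have \<epsilon>: "0 < \<epsilon>" "kset_close \<epsilon> \<Gamma> \<Gamma>'" "\<epsilon> < r" "\<epsilon> < 1 / (norm z + 1)" by (auto simp: e_def)
      obtain y where "y \<in> \<Gamma>' j" "dist y z < \<epsilon>"
        using kset_closeD2[OF \<epsilon>(2) z(1)] less_inverse_if_less[OF \<epsilon>(1,4)] by auto
      moreover from this have "y \<in> U" using r(2) \<epsilon>(3) by (auto simp: dist_commute)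
      ultimately show "\<Gamma>' \<in> V" using G' by (auto simp: V_def)
    qed
    ultimately show "\<exists>r>0. mball \<Gamma> r \<subseteq> V" by blast
  qed
  then have "openin (subtopology kset_topology (orbit_closure \<Lambda>)) (hitting \<Lambda> j U)"
    unfolding openin_subtopology kset_topology_def
    using orbit_closure_subset[of \<Lambda>] by (intro exI[of _ V]) (auto simp: V_def hitting_def)
  then have "hitting \<Lambda> j U \<in> sets (orbit_closure_borel \<Lambda>)"
    unfolding orbit_closure_borel_def by (intro in_measure_of) (use openin_subset in force)+
  then show ?thesis using \<mu> by (simp add: invariant_borel_probability_def)
qed

lemma translate_translate: "translate g (translate h \<Gamma>) = translate (h + g) \<Gamma>"
  by (simp add: translate_def image_image diff_diff_eq)

text \<open>
  Invariance yields this without a continuity argument: the translate of the whole space has measure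
  1, and sets outside the \<open>\<sigma>\<close>-algebra have \<^const>\<open>emeasure\<close> 0.
\<close>

lemma translate_orbit_closure:
  assumes \<mu>: "invariant_borel_probability \<Lambda> \<mu>" and "\<Gamma> \<in> orbit_closure \<Lambda>"
  shows "translate g \<Gamma> \<in> orbit_closure \<Lambda>"
proof -
  interpret prob_space \<mu> using \<mu> by (simp add: invariant_borel_probability_def)
  have "emeasure \<mu> (translate g ` space \<mu>) = emeasure \<mu> (space \<mu>)"
    using \<mu> sets.top unfolding invariant_borel_probability_def by blast
  then have "emeasure \<mu> (translate g ` space \<mu>) \<noteq> 0" using emeasure_space_1 by simp
  then have "translate g ` space \<mu> \<in> sets \<mu>" using emeasure_notin_sets by blast
  then have "translate g ` space \<mu> \<subseteq> space \<mu>" by (rule sets.sets_into_space)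
  then show ?thesis
    using assms(2) unfolding invariant_borel_probability_space[OF \<mu>] by blast
qed

lemma translate_hitting:
  assumes \<mu>: "invariant_borel_probability \<Lambda> \<mu>"
  shows "translate g ` hitting \<Lambda> j U = hitting \<Lambda> j ((\<lambda>x. x - g) ` U)"
proof (intro equalityI subsetI)
  fix \<Gamma>' assume "\<Gamma>' \<in> translate g ` hitting \<Lambda> j U"
  then obtain \<Gamma> z where z: "\<Gamma> \<in> orbit_closure \<Lambda>" "z \<in> \<Gamma> j" "z \<in> U" "\<Gamma>' = translate g \<Gamma>"
    unfolding hitting_def by blast
  then have "z - g \<in> \<Gamma>' j" unfolding translate_def by blast
  with z translate_orbit_closure[OF \<mu> z(1)] show "\<Gamma>' \<in> hitting \<Lambda> j ((\<lambda>x. x - g) ` U)"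
    unfolding hitting_def by blast
next
  fix \<Gamma> assume "\<Gamma> \<in> hitting \<Lambda> j ((\<lambda>x. x - g) ` U)"
  then obtain u where u: "\<Gamma> \<in> orbit_closure \<Lambda>" "u - g \<in> \<Gamma> j" "u \<in> U"
    unfolding hitting_def by blast
  have "u - g - - g \<in> translate (- g) \<Gamma> j" using u(2) unfolding translate_def by blast
  then have "u \<in> translate (- g) \<Gamma> j" by simp
  then have "translate (- g) \<Gamma> \<in> hitting \<Lambda> j U"
    using u(3) translate_orbit_closure[OF \<mu> u(1)] unfolding hitting_def by blast
  moreover have "\<Gamma> = translate g (translate (- g) \<Gamma>)"
    unfolding translate_translate by (simp add: translate_def)
  ultimately show "\<Gamma> \<in> translate g ` hitting \<Lambda> j U" by blast
qed

section \<open>Return probabilities\<close>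

text \<open>
  An open neighbourhood of the half-open cell of side \<open>s\<close> at \<open>v\<close> that still contains the points after
  a perturbation by less than \<open>s\<close>.
\<close>

definition fat_cell :: "real \<Rightarrow> real ^ 'n \<Rightarrow> (real ^ 'n::finite) set" where
  "fat_cell s v = box (\<chi> k. v $ k - s) (\<chi> k. v $ k + 2 * s)"

lemma mem_fat_cell: "x \<in> fat_cell s v \<longleftrightarrow> (\<forall>k. v $ k - s < x $ k \<and> x $ k < v $ k + 2 * s)"
  by (simp add: fat_cell_def mem_box_cart)

lemma translate_fat_cell: "(\<lambda>x. x - g) ` fat_cell s v = fat_cell s (v - g)"
proof (intro equalityI subsetI)
  fix x assume "x \<in> fat_cell s (v - g)"
  then have "x + g \<in> fat_cell s v" by (simp add: mem_fat_cell algebra_simps)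
  then have "x + g - g \<in> (\<lambda>x. x - g) ` fat_cell s v" by (rule imageI)
  then show "x \<in> (\<lambda>x. x - g) ` fat_cell s v" by simp
qed (auto simp: mem_fat_cell)

lemma hitting_fat_cell_measurable:
  assumes "invariant_borel_probability \<Lambda> \<mu>"
  shows "hitting \<Lambda> j (fat_cell s v) \<in> sets \<mu>"
  by (intro open_hitting_measurable assms) (simp add: fat_cell_def open_box)

lemma translate_hitting_fat_cell:
  assumes "invariant_borel_probability \<Lambda> \<mu>"
  shows "translate g ` hitting \<Lambda> j (fat_cell s v) = hitting \<Lambda> j (fat_cell s (v - g))"
  by (simp add: translate_hitting[OF assms] translate_fat_cell)

lemma inj_translate: "inj (translate g)"
proof (rule injI)
  fix \<Gamma> \<Gamma>' assume "translate g \<Gamma> = translate g \<Gamma>'"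
  then have "translate (- g) (translate g \<Gamma>) = translate (- g) (translate g \<Gamma>')" by simp
  then show "\<Gamma> = \<Gamma>'" unfolding translate_translate by (simp add: translate_def)
qed

text \<open>Translating by \<open>v\<close> carries the two cells to \<open>0\<close> and
  \<open>g\<close>, and the measure is invariant.\<close>

lemma measure_hitting_fat_cell_Int:
  assumes \<mu>: "invariant_borel_probability \<Lambda> \<mu>"
  shows "measure \<mu> (hitting \<Lambda> j (fat_cell s v) \<inter> hitting \<Lambda> j (fat_cell s (v + g))) =
    measure \<mu> (hitting \<Lambda> j (fat_cell s 0) \<inter> hitting \<Lambda> j (fat_cell s g))"
proof -
  let ?H = "\<lambda>v. hitting \<Lambda> j (fat_cell s v)"
  have "translate v ` (?H v \<inter> ?H (v + g)) = ?H 0 \<inter> ?H g"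
    by (simp add: image_Int[OF inj_translate] translate_hitting_fat_cell[OF \<mu>])
  moreover have "emeasure \<mu> (translate v ` (?H v \<inter> ?H (v + g))) = emeasure \<mu> (?H v \<inter> ?H (v + g))"
    using \<mu> sets.Int[OF hitting_fat_cell_measurable[OF \<mu>] hitting_fat_cell_measurable[OF \<mu>]]
    unfolding invariant_borel_probability_def by blast
  ultimately show ?thesis by (simp add: measure_def)
qed

lemma measure_hitting_fat_cell:
  assumes \<mu>: "invariant_borel_probability \<Lambda> \<mu>"
  shows "measure \<mu> (hitting \<Lambda> j (fat_cell s v)) = measure \<mu> (hitting \<Lambda> j (fat_cell s 0))"
  using measure_hitting_fat_cell_Int[OF \<mu>, of j s v 0] by simp

text \<open>A block of \<open>q ^ CARD('n)\<close> disjoint fat cells, each of side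
  \<open>3 * s\<close>, is too small to contain two points of colour \<open>j\<close>. The
  corresponding events are therefore disjoint, and by invariance equally likely.\<close>

lemma measure_hitting_fat_cell_le:
  fixes \<Lambda> :: "'k::finite \<Rightarrow> (real ^ 'n::finite) set" and q :: nat and s :: real
  assumes \<mu>: "invariant_borel_probability \<Lambda> \<mu>"
    and sep: "\<And>x y. x \<in> \<Lambda> j \<Longrightarrow> y \<in> \<Lambda> j \<Longrightarrow> dist x y < a \<Longrightarrow> x = y"
    and s: "0 < s" "CARD('n) * (3 * s * q) \<le> a" and q: "0 < q"
  shows "q ^ CARD('n) * measure \<mu> (hitting \<Lambda> j (fat_cell s 0)) \<le> 1"
proof -
  interpret prob_space \<mu> using \<mu> by (simp add: invariant_borel_probability_def)
  let ?W = "(UNIV :: 'n set) \<rightarrow>\<^sub>E {0..<int q}"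
  define H where "H w = hitting \<Lambda> j (fat_cell s (\<chi> k. 3 * s * of_int (w k)))" for w :: "'n \<Rightarrow> int"
  have Hm: "H w \<in> events" for w
    unfolding H_def by (rule hitting_fat_cell_measurable[OF \<mu>])
  have finW: "finite ?W" by (intro finite_PiE) auto
  have cardW: "card ?W = q ^ CARD('n)" by (simp add: card_PiE)
  have "disjoint_family_on H ?W"
    unfolding disjoint_family_on_def
  proof (intro ballI impI, rule ccontr)
    fix w w' assume w: "w \<in> ?W" "w' \<in> ?W" "w \<noteq> w'" "H w \<inter> H w' \<noteq> {}"
    then obtain \<Gamma> z z' where z: "\<Gamma> \<in> orbit_closure \<Lambda>" "z \<in> \<Gamma> j" "z' \<in> \<Gamma> j"
        "z \<in> fat_cell s (\<chi> k. 3 * s * of_int (w k))" "z' \<in> fat_cell s (\<chi> k. 3 * s * of_int (w' k))"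
      unfolding H_def hitting_def by blast
    \<comment> \<open>A fat cell begins at \<open>v - s\<close>, so the shift by \<open>s\<close>
      aligns the block with the grid of side \<open>3 * s\<close> through the origin; a point then
      determines its index.\<close>
    have cell: "\<lfloor>(x + (\<chi> k. s)) $ k / (3 * s)\<rfloor> = u k"
      if "x \<in> fat_cell s (\<chi> k. 3 * s * of_int (u k))" for x and u :: "'n \<Rightarrow> int" and k
    proof -
      have "3 * s * of_int (u k) < x $ k + s" "x $ k + s < 3 * s * (of_int (u k) + 1)"
        using that by (simp_all add: mem_fat_cell algebra_simps)
      then show ?thesis
        using s(1) by (intro floor_unique) (simp_all add: pos_le_divide_eq pos_divide_less_eq mult.commute)
    qed
    \<comment> \<open>After the shift the whole block lies in a single cell of side
      \<open>3 * s * q\<close>.\<close>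
    have big: "\<lfloor>(x + (\<chi> k. s)) $ k / (3 * s * q)\<rfloor> = 0"
      if x: "x \<in> fat_cell s (\<chi> k. 3 * s * of_int (u k))" and u: "u \<in> ?W" for x u k
    proof -
      have uk: "0 \<le> u k" "u k + 1 \<le> int q" using PiE_mem[OF u, of k] by simp_all
      have "3 * s * of_int (u k) < x $ k + s" "x $ k + s < 3 * s * (of_int (u k) + 1)"
        using x by (simp_all add: mem_fat_cell algebra_simps)
      moreover have "0 \<le> 3 * s * of_int (u k)" using s(1) uk(1) by simp
      moreover have "3 * s * (of_int (u k) + 1) \<le> 3 * s * q"
        using s(1) uk(2) by (intro mult_left_mono) linarith+
      ultimately have "0 \<le> x $ k + s" "x $ k + s < 3 * s * q" by linarith+
      then show ?thesis using s(1) q by (simp add: floor_eq_iff)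
    qed
    have "dist (z + (\<chi> k. s)) (z' + (\<chi> k. s)) < CARD('n) * (3 * s * q)"
      using s(1) q by (intro dist_less_if_same_cell) (simp_all only: big[OF z(4) w(1)] big[OF z(5) w(2)], simp)
    then have "dist z z' < a" using s(2) by simp
    then have "z = z'" using orbit_closure_separated[OF sep z(1-3)] by blast
    then have "w k = w' k" for k using cell[OF z(4), of k] cell[OF z(5), of k] by simp
    with w(3) show False by blast
  qed
  then have "measure \<mu> (\<Union>w\<in>?W. H w) = (\<Sum>w\<in>?W. measure \<mu> (H w))"
    using finW Hm by (intro finite_measure_finite_Union) auto
  also have "\<dots> = (\<Sum>w\<in>?W. measure \<mu> (hitting \<Lambda> j (fat_cell s 0)))"
    unfolding H_def by (rule sum.cong[OF refl measure_hitting_fat_cell[OF \<mu>]])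
  also have "\<dots> = q ^ CARD('n) * measure \<mu> (hitting \<Lambda> j (fat_cell s 0))"
    by (simp add: cardW)
  finally have eq: "measure \<mu> (\<Union>w\<in>?W. H w) = q ^ CARD('n) * measure \<mu> (hitting \<Lambda> j (fat_cell s 0))" .
  show ?thesis unfolding eq[symmetric] by (rule prob_le_1)
qed

text \<open>The sum of the probabilities is the expectation of the number of events that
  occur.\<close>

lemma (in prob_space) sum_prob_ge_if_card_ge:
  fixes c :: real
  assumes W: "finite W" and E: "\<And>w. w \<in> W \<Longrightarrow> E w \<in> events"
    and c: "\<And>x. x \<in> space M \<Longrightarrow> c \<le> card {w \<in> W. x \<in> E w}"
  shows "c \<le> (\<Sum>w\<in>W. prob (E w))"
proof -
  have int: "integrable M (\<lambda>x. \<Sum>w\<in>W. indicator (E w) x :: real)"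
    using E by (intro Bochner_Integration.integrable_sum integrable_real_indicator) (auto simp: emeasure_eq_measure)
  have "c \<le> expectation (\<lambda>x. \<Sum>w\<in>W. indicator (E w) x)"
  proof (rule integral_ge_const[OF int], rule AE_I2)
    fix x assume "x \<in> space M"
    moreover have "(\<Sum>w\<in>W. indicator (E w) x :: real) = card {w \<in> W. x \<in> E w}"
      using W by (simp add: indicator_def sum.If_cases Int_def)
    ultimately show "c \<le> (\<Sum>w\<in>W. indicator (E w) x)" using c by simp
  qed
  also have "\<dots> = (\<Sum>w\<in>W. prob (E w))"
    using E by (subst Bochner_Integration.integral_sum)
      (auto simp: emeasure_eq_measure intro!: sum.cong integrable_real_indicator)
  finally show ?thesis .
qed

text \<open>Every \<open>\<Gamma>\<close> looks like a translate of \<open>\<Lambda>\<close> on a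
  large window, so the count of returning cells applies to it. Averaging this count over
  \<open>\<Gamma>\<close> and using invariance bounds the probability at a single cell.\<close>

lemma measure_hitting_fat_cell_Int_ge:
  fixes \<Lambda> :: "'k::finite \<Rightarrow> (real ^ 'n::finite) set" and a r s L \<rho> :: real and l K :: nat
  assumes \<mu>: "invariant_borel_probability \<Lambda> \<mu>"
    and dense: "\<And>y. \<exists>x\<in>\<Lambda> j. dist x y \<le> r"
    and sep: "\<And>x y. x \<in> \<Lambda> j \<Longrightarrow> y \<in> \<Lambda> j \<Longrightarrow> dist x y < a \<Longrightarrow> x = y"
    and \<phi>: "\<And>z. z \<in> \<Lambda> j \<Longrightarrow> \<phi> z \<in> \<Lambda> j" "\<And>z. z \<in> \<Lambda> j \<Longrightarrow> \<phi> z + g \<in> \<Lambda> j"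
      "\<And>z. z \<in> \<Lambda> j \<Longrightarrow> dist (\<phi> z) z \<le> \<rho>"
    and K: "\<And>p. finite {z \<in> \<Lambda> j. \<phi> z = p}" "\<And>p. card {z \<in> \<Lambda> j. \<phi> z = p} \<le> K"
    and L: "2 * r < L" "0 < L" and l: "0 < l" and s: "s = L / l" "CARD('n) * s \<le> a"
  shows "1 \<le> K * (2 * l) ^ CARD('n) *
    measure \<mu> (hitting \<Lambda> j (fat_cell s 0) \<inter> hitting \<Lambda> j (fat_cell s g))"
    (is "_ \<le> _ * ?p")
proof -
  interpret prob_space \<mu> using \<mu> by (simp add: invariant_borel_probability_def)
  have s0: "0 < s" using L l s by simp
  obtain N0 :: nat where "\<rho> / L \<le> N0" using real_arch_simple by blast
  then have N0: "\<rho> \<le> N0 * L" using L(2) by (simp add: pos_divide_le_eq)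
  define N where "N = Suc N0"
  have N: "\<rho> \<le> N * L" "0 < N" using N0 L(2) by (simp_all add: N_def algebra_simps)
  \<comment> \<open>Taking \<open>2 * N\<close> cubes per axis with a margin of \<open>N\<close> on
    each side makes the window just twice as wide as the block. Hence \<open>N\<close>, and with it
    \<open>\<rho>\<close>, cancels from the final bound.\<close>
  define m where "m = (2 * N + 2 * N) * l"
  have m_eq: "m = 2 * N * (2 * l)" by (simp add: m_def)
  let ?W = "(UNIV :: 'n set) \<rightarrow>\<^sub>E {0..<int m}"
  define v where "v w = (\<chi> k. s * of_int (w k))" for w :: "'n \<Rightarrow> int"
  define H where "H w = hitting \<Lambda> j (fat_cell s (v w)) \<inter> hitting \<Lambda> j (fat_cell s (v w + g))" for w
  have finW: "finite ?W" by (intro finite_PiE) auto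
  have cardW: "card ?W = m ^ CARD('n)" by (simp add: card_PiE)
  have count: "(2 * N) ^ CARD('n) \<le> K * card {w \<in> ?W. \<Gamma> \<in> H w}" if \<Gamma>: "\<Gamma> \<in> orbit_closure \<Lambda>" for \<Gamma>
  proof -
    \<comment> \<open>This bounds the norm of every window point and of its translate by
      \<open>g\<close>, so that both are seen by the approximation.\<close>
    define b where "b = CARD('n) * (s * m) + norm g"
    have b0: "0 \<le> b" using s0 by (simp add: b_def)
    define e where "e = min s (1 / (b + 1))"
    have "0 < e" using s0 b0 by (simp add: e_def)
    then obtain c \<epsilon> where \<epsilon>: "0 < \<epsilon>" "\<epsilon> < e" "kset_close \<epsilon> \<Gamma> (translate c \<Lambda>)"
      using orbit_closure_approx[OF \<Gamma>] by blast
    have b: "b < 1 / \<epsilon>" using less_inverse_if_less[OF \<epsilon>(1) _ b0] \<epsilon>(2) by (simp add: e_def)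
    have near: "\<Gamma> \<in> hitting \<Lambda> j (fat_cell s u)"
      if y: "y \<in> translate c \<Lambda> j" "norm y < 1 / \<epsilon>" "\<And>k. u $ k \<le> y $ k \<and> y $ k < u $ k + s" for y u
    proof -
      obtain x where x: "x \<in> \<Gamma> j" "dist x y < \<epsilon>" using kset_closeD1[OF \<epsilon>(3) y(1,2)] by blast
      have "\<bar>x $ k - y $ k\<bar> < s" for k
        using component_le_norm_cart[of "x - y" k] x(2) \<epsilon>(2) by (simp add: dist_norm e_def)
      then have "u $ k - s < x $ k \<and> x $ k < u $ k + 2 * s" for k
        using y(3)[of k] by (smt (verit))
      then have "x \<in> fat_cell s u" by (simp add: mem_fat_cell)
      with x(1) \<Gamma> show ?thesis unfolding hitting_def by blast
    qed
    let ?V = "{w \<in> ?W. \<exists>z\<in>\<Lambda> j. z + g \<in> \<Lambda> j \<and> (\<forall>k. \<lfloor>(z - c) $ k / s\<rfloor> = w k)}"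
    have "?V \<subseteq> {w \<in> ?W. \<Gamma> \<in> H w}"
    proof (intro subsetI, elim CollectE conjE bexE, intro CollectI conjI)
      fix w z assume w: "w \<in> ?W" and z: "z \<in> \<Lambda> j" "z + g \<in> \<Lambda> j" "\<forall>k. \<lfloor>(z - c) $ k / s\<rfloor> = w k"
      have k: "v w $ k \<le> (z - c) $ k" "(z - c) $ k < v w $ k + s" for k
      proof -
        have "of_int (w k) \<le> (z - c) $ k / s" "(z - c) $ k / s < of_int (w k) + 1"
          using z(3) by (metis floor_eq_iff)+
        then show "v w $ k \<le> (z - c) $ k" "(z - c) $ k < v w $ k + s"
          using s0 by (simp_all add: v_def field_simps)
      qed
      have "\<bar>(z - c) $ k\<bar> \<le> s * m" for k
      proof -
        have wk: "0 \<le> w k" "w k + 1 \<le> int m" using PiE_mem[OF w, of k] by simp_all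
        have "0 \<le> v w $ k" using wk(1) s0 by (simp add: v_def)
        moreover have "s * (of_int (w k) + 1) \<le> s * m"
          using s0 wk(2) by (intro mult_left_mono) linarith+
        then have "v w $ k + s \<le> s * m" by (simp add: v_def algebra_simps)
        ultimately show ?thesis using k[of k] by linarith
      qed
      then have "(\<Sum>k\<in>UNIV. \<bar>(z - c) $ k\<bar>) \<le> (\<Sum>k\<in>(UNIV :: 'n set). s * m)"
        by (intro sum_mono)
      then have n1: "norm (z - c) \<le> CARD('n) * (s * m)"
        using norm_le_l1_cart[of "z - c"] by simp
      have n2: "norm (z - c + g) \<le> b"
        using norm_triangle_ineq[of "z - c" g] n1 by (simp add: b_def)
      have "norm (z - c) \<le> b" using n1 norm_ge_zero[of g] unfolding b_def by linarith
      then have "\<Gamma> \<in> hitting \<Lambda> j (fat_cell s (v w))"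
        using b k z(1) by (intro near[of "z - c"]) (auto simp: translate_def)
      moreover have "z - c + g \<in> translate c \<Lambda> j"
        unfolding translate_def by (rule image_eqI[OF _ z(2)]) simp
      then have "\<Gamma> \<in> hitting \<Lambda> j (fat_cell s (v w + g))"
        using b n2 k by (intro near[of "z - c + g"]) auto
      ultimately show "\<Gamma> \<in> H w" by (simp add: H_def)
    qed
    then have "card ?V \<le> card {w \<in> ?W. \<Gamma> \<in> H w}" using finW by (intro card_mono) auto
    moreover have "(2 * N) ^ CARD('n) \<le> K * card ?V"
      using card_returning_cells[OF dense sep \<phi> K L l s N(1), of "2 * N" c] unfolding m_def .
    ultimately show ?thesis by (meson mult_le_mono2 order_trans)
  qed
  \<comment> \<open>For \<open>K = 0\<close> the count would vanish at any element of the orbit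
    closure, which is non-empty as the space of a probability measure.\<close>
  have K0: "0 < K"
  proof (rule ccontr)
    assume "\<not> 0 < K"
    obtain \<Gamma> where "\<Gamma> \<in> orbit_closure \<Lambda>"
      using not_empty invariant_borel_probability_space[OF \<mu>] by blast
    from count[OF this] \<open>\<not> 0 < K\<close> N(2) show False by simp
  qed
  have "(2 * N) ^ CARD('n) / K \<le> (\<Sum>w\<in>?W. prob (H w))"
  proof (rule sum_prob_ge_if_card_ge[OF finW])
    show "H w \<in> events" for w
      unfolding H_def by (intro sets.Int hitting_fat_cell_measurable[OF \<mu>])
    fix \<Gamma> assume "\<Gamma> \<in> space \<mu>"
    then have "real ((2 * N) ^ CARD('n)) \<le> real (K * card {w \<in> ?W. \<Gamma> \<in> H w})"
      using count invariant_borel_probability_space[OF \<mu>] by (intro of_nat_mono) auto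
    then show "(2 * N) ^ CARD('n) / K \<le> card {w \<in> ?W. \<Gamma> \<in> H w}"
      using K0 by (simp add: pos_divide_le_eq mult.commute)
  qed
  also have "\<dots> = (\<Sum>w\<in>?W. ?p)"
    unfolding H_def by (rule sum.cong[OF refl measure_hitting_fat_cell_Int[OF \<mu>]])
  also have "\<dots> = m ^ CARD('n) * ?p"
    by (simp add: cardW)
  also have "real (m ^ CARD('n)) = real (2 * N) ^ CARD('n) * (2 * l) ^ CARD('n)"
    by (simp only: m_eq of_nat_mult of_nat_power of_nat_numeral power_mult_distrib)
  finally have "real (2 * N) ^ CARD('n) \<le> real (2 * N) ^ CARD('n) * (K * (2 * l) ^ CARD('n) * ?p)"
    using K0 by (simp add: pos_divide_le_eq mult_ac)
  then show ?thesis using N(2) by simp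
qed

section \<open>Mixing along the vectors \<open>(Q ^^ n) (v i)\<close> contradicts the two
  probability bounds\<close>

theorem corollary5p2:
  fixes \<Lambda> :: "'k::finite \<Rightarrow> (real ^ 'n::finite) set"
    and Q :: "real ^ 'n \<Rightarrow> real ^ 'n"
    and \<D> :: "'k \<Rightarrow> 'k \<Rightarrow> (real ^ 'n) set"
    and \<mu> :: "('k \<Rightarrow> (real ^ 'n) set) measure"
  assumes "substitution_delone_kset Q \<D> \<Lambda>"
    and "primitive_substitution \<D>"
    and "representable Q \<D> \<Lambda>"
    and "invariant_borel_probability \<Lambda> \<mu>"
  shows "\<not> strongly_mixing \<mu>"
proof
  assume mixing: "strongly_mixing \<mu>"
  note \<mu> = assms(4)
  have exp: "expansive Q" using assms(1) unfolding substitution_delone_kset_def by blast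
  have dec: "decomposition Q \<D> \<Lambda>"
    by (rule substitution_decomposition[OF assms(1) bij_is_inj[OF expansive_bij[OF exp]]])
  have lin: "linear Q" using exp by (simp add: expansive_def)
  have ud: "uniform_discrete (\<Lambda> i)" and rd: "relatively_dense (\<Lambda> i)" for i
    using assms(1) unfolding substitution_delone_kset_def delone_kset_def delone_def by blast+
  \<comment> \<open>Any colour serves; \<open>undefined\<close> merely names one.\<close>
  define j :: 'k where "j = undefined"
  obtain a where a: "0 < a" "\<And>x y. x \<in> \<Lambda> j \<Longrightarrow> y \<in> \<Lambda> j \<Longrightarrow> dist x y < a \<Longrightarrow> x = y"
    by (rule uniform_discreteE[OF ud[of j]]) blast
  obtain r where r: "0 < r" "\<And>y. \<exists>x\<in>\<Lambda> j. dist x y \<le> r"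
    by (rule relatively_denseE[OF rd[of j]]) blast
  have "\<forall>i. \<exists>v r. v \<noteq> 0 \<and> (\<forall>y. \<exists>x\<in>\<Lambda> i. x + v \<in> \<Lambda> i \<and> dist x y \<le> r)"
    using exists_return_vector[OF exp dec ud rd] by blast
  then obtain v t where v: "\<And>i. v i \<noteq> 0" "\<And>i y. \<exists>x\<in>\<Lambda> i. x + v i \<in> \<Lambda> i \<and> dist x y \<le> t i"
    by metis
  define T where "T = Max (range t)"
  have T: "t i \<le> T" for i unfolding T_def by (intro Max_ge) auto
  have "\<forall>i y. \<exists>x. x \<in> \<Lambda> i \<and> x + v i \<in> \<Lambda> i \<and> dist x y \<le> T"
    using v(2) T order_trans by blast
  then obtain \<sigma> where \<sigma>: "\<And>i y. \<sigma> i y \<in> \<Lambda> i" "\<And>i y. \<sigma> i y + v i \<in> \<Lambda> i" "\<And>i y. dist (\<sigma> i y) y \<le> T"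
    by metis
  have "\<forall>i. \<exists>K. \<forall>p. finite {x \<in> \<Lambda> i. dist x p \<le> T} \<and> card {x \<in> \<Lambda> i. dist x p \<le> T} \<le> K"
    using uniform_discrete_card_bounded[OF ud] by blast
  then obtain K0 where K0: "\<And>i p. finite {x \<in> \<Lambda> i. dist x p \<le> T}"
      "\<And>i p. card {x \<in> \<Lambda> i. dist x p \<le> T} \<le> K0 i"
    by metis
  define K1 where "K1 = Max (range K0)"
  have "K0 i \<le> K1" for i unfolding K1_def by (intro Max_ge) auto
  then have K1: "card {x \<in> \<Lambda> i. dist x p \<le> T} \<le> K1" for i p using K0(2) order_trans by blast
  \<comment> \<open>The \<open>+ 1\<close> makes \<open>K\<close> positive, so that
    \<open>K \<le> K ^ d\<close> in the final estimate.\<close>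
  define K where "K = CARD('k) * K1 + 1"
  define d where "d = CARD('n)"
  define L where "L = 3 * r"
  have L: "2 * r < L" "0 < L" using r(1) by (simp_all add: L_def)
  obtain b0 :: nat where b0: "d * L / a \<le> b0" using real_arch_simple by blast
  define b where "b = Suc b0"
  have b: "0 < b" "d * (L / b) \<le> a"
    using b0 a(1) by (simp_all add: b_def field_simps)
  \<comment> \<open>The argument ends with \<open>q ^ d \<le> (6 * b * K) ^ d\<close>, which this
    \<open>q\<close> violates. With \<open>l = 3 * b * q\<close>, a block of \<open>q\<close> fat
    cells per axis has side \<open>3 * s * q = L / b\<close>.\<close>
  define q where "q = 6 * b * K + 1"
  define l where "l = 3 * b * q"
  define s where "s = L / l"
  have l: "0 < l" using b by (simp add: l_def q_def)
  have s0: "0 < s" using L l by (simp add: s_def)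
  have "0 < q" by (simp add: q_def)
  then have sq: "3 * s * q = L / b" using b(1) by (simp add: s_def l_def)
  have "s * 1 \<le> s * (3 * q)" using s0 by (intro mult_left_mono) (simp_all add: q_def)
  then have "d * s \<le> d * (3 * s * q)" by (intro mult_left_mono) (simp_all add: mult_ac)
  then have s: "d * (3 * s * q) \<le> a" "d * s \<le> a" using b(2) unfolding sq by linarith+
  let ?H = "\<lambda>u. hitting \<Lambda> j (fat_cell s u)"
  define c where "c = measure \<mu> (?H 0)"
  have upper: "q ^ d * c \<le> 1"
    unfolding c_def d_def
    by (rule measure_hitting_fat_cell_le[OF \<mu> a(2) s0 s(1)[unfolded d_def]]) (simp_all add: q_def)
  have "\<exists>i. 1 \<le> K * (2 * l) ^ d * measure \<mu> (?H 0 \<inter> ?H ((Q ^^ n) (v i)))" for n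
  proof -
    obtain E where E: "decomposition (Q ^^ n) E \<Lambda>" using decomposition_power[OF dec lin] by blast
    obtain i \<rho> \<phi> where \<phi>: "\<And>z. z \<in> \<Lambda> j \<Longrightarrow> \<phi> z \<in> \<Lambda> j" "\<And>z. z \<in> \<Lambda> j \<Longrightarrow> \<phi> z + (Q ^^ n) (v i) \<in> \<Lambda> j"
        "\<And>z. z \<in> \<Lambda> j \<Longrightarrow> dist (\<phi> z) z \<le> \<rho>"
        "\<And>p. finite {z \<in> \<Lambda> j. \<phi> z = p}" "\<And>p. card {z \<in> \<Lambda> j. \<phi> z = p} \<le> CARD('k) * K1"
      using exists_map_to_returning_points[OF E expansive_linear_power[OF exp] \<sigma> K0(1) K1, of j]
      by blast
    have "card {z \<in> \<Lambda> j. \<phi> z = p} \<le> K" for p using \<phi>(5)[of p] by (simp add: K_def)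
    from measure_hitting_fat_cell_Int_ge[OF \<mu> r(2) a(2) \<phi>(1-4) this L l s_def s(2)[unfolded d_def]]
    show ?thesis unfolding d_def by blast
  qed
  then obtain i where i: "\<And>n. 1 \<le> K * (2 * l) ^ d * measure \<mu> (?H 0 \<inter> ?H ((Q ^^ n) (v (i n))))"
    by metis
  define g where "g n = (Q ^^ n) (v (i n))" for n
  \<comment> \<open>The colour \<open>i n\<close> may change with \<open>n\<close>, so divergence is
    required uniformly over the finitely many vectors \<open>v i\<close>.\<close>
  have "\<forall>\<^sub>F n in sequentially. \<forall>i\<in>UNIV. Z \<le> norm ((Q ^^ n) (v i))" for Z
    using expansive_power_norm_at_top[OF exp v(1)] unfolding filterlim_at_top
    by (intro eventually_ball_finite) auto
  then have "\<forall>\<^sub>F n in sequentially. Z \<le> norm (g n)" for Z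
    unfolding g_def by (rule eventually_mono) blast
  \<comment> \<open>The sign appears because \<open>translate\<close> subtracts:
    \<open>translate (- g n)\<close> carries the cell at \<open>0\<close> to the cell at
    \<open>g n\<close>.\<close>
  then have "filterlim (\<lambda>n. - g n) at_infinity sequentially"
    by (simp add: filterlim_at_infinity_conv_norm_at_top filterlim_at_top)
  moreover have "((\<lambda>g. measure \<mu> (?H 0 \<inter> translate g ` ?H 0)) \<longlongrightarrow> c * c) at_infinity"
    using mixing hitting_fat_cell_measurable[OF \<mu>] unfolding strongly_mixing_def c_def by blast
  ultimately have "(\<lambda>n. measure \<mu> (?H 0 \<inter> translate (- g n) ` ?H 0)) \<longlonglongrightarrow> c * c"
    by (rule filterlim_compose[rotated])
  then have "(\<lambda>n. measure \<mu> (?H 0 \<inter> ?H (g n))) \<longlonglongrightarrow> c * c"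
    by (simp add: translate_hitting_fat_cell[OF \<mu>])
  then have "(\<lambda>n. K * (2 * l) ^ d * measure \<mu> (?H 0 \<inter> ?H (g n))) \<longlonglongrightarrow> K * (2 * l) ^ d * (c * c)"
    by (rule tendsto_mult_left)
  then have lower: "1 \<le> K * (2 * l) ^ d * (c * c)"
    by (rule LIMSEQ_le_const) (use i in \<open>auto simp: g_def\<close>)
  have c0: "0 \<le> c" by (simp add: c_def)
  \<comment> \<open>Since \<open>2 * l = 6 * b * q\<close>, the right side contains
    \<open>q ^ d\<close> twice, one factor for each \<open>c\<close>; the upper bound
    \<open>q ^ d * c \<le> 1\<close> then removes both.\<close>
  have "real q ^ d \<le> real q ^ d * (K * (2 * l) ^ d * (c * c))"
    using lower mult_left_mono[of 1 _ "real q ^ d"] by simp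
  also have "\<dots> = K * (6 * b) ^ d * (q ^ d * c) * (q ^ d * c)"
  proof -
    have "2 * l = 6 * b * q" by (simp add: l_def)
    then have "real (2 * l) ^ d = real (6 * b) ^ d * real q ^ d"
      by (simp only: of_nat_mult power_mult_distrib)
    then show ?thesis by (simp add: mult_ac)
  qed
  also have "\<dots> \<le> real (K * (6 * b) ^ d) * 1 * 1"
    using upper c0 by (intro mult_mono) simp_all
  finally have "real (q ^ d) \<le> real (K * (6 * b) ^ d)" by (simp only: mult_1_right of_nat_power)
  then have "q ^ d \<le> K * (6 * b) ^ d" by (simp only: of_nat_le_iff)
  also have "\<dots> \<le> K ^ d * (6 * b) ^ d"
    by (intro mult_right_mono self_le_power) (simp_all add: K_def d_def)
  also have "\<dots> = (6 * b * K) ^ d" by (simp only: power_mult_distrib mult.commute)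
  also have "\<dots> < q ^ d" by (intro power_strict_mono) (simp_all add: q_def d_def)
  finally show False by simp
qed

end
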